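(* Let $n\ge 1$ and let $G$ be a loopless graph on the vertex set $[n+1]$ in which the only edges allowed to have multiplicity greater than $1$ are those of the form $(1,l)$. The normalized volume $\operatorname{vol}(\mathcal{F}_{\tilde G})$ is equal to the number of triangular arrays of nonnegative integers $(b_{i,j})_{i>j}$, $j\in[n-1]$, $i\in\{j+1,\ldots,n\}$, satisfying $$b_{n,i}+b_{n-1,i}+\cdots+b_{i+1,i}\le |E(G[i+1])|-|E(G[i])|+\sum_{k=1}^{i-1}b_{i,k}\qquad\text{for all } i\in[n-1],$$ and $b_{j,i}=0$ whenever $(i+1,j+1)\notin E(G)$ (for $1\le i<j\le n$).
   Context: Graphs may have multiple edges (distinct parallel edges are different elements of the edge multiset); vertex sets are totally ordered; an edge is written $(i,j)$ with $i<j$, $i$ being its initial and $j$ its final vertex. $[N]=\{1,\dots,N\}$. $G[i]$ is the restriction of $G$ to the vertex set $[i]$, and $|E(\cdot)|$ counts edges with multiplicity. For $G=([n+1],E)$, $\tilde G$ is the graph on $[n+1]\cup\{s,t\}$, with $s$ smaller and $t$ larger than all of $[n+1]$, and edge multiset $E\cup\{(s,i),(i,t): i\in[n+1]\}$. The flow polytope $\mathcal{F}_H$ of a graph $H$ with smallest vertex $s$ and largest vertex $t$ is the set of functions $f:E(H)\to\mathbb{R}_{\ge0}$ such that the total $f$-value of edges with initial vertex $s$ is $1$, the total $f$-value of edges with final vertex $t$ is $1$, and at every other vertex the total incoming $f$-value equals the total outgoing $f$-value. $\operatorname{vol}$ is normalized volume (with respect to the integer lattice in the affine hull, a unimodular simplex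 having volume $1$). *)

theory Defs
  imports "HOL-Analysis.Analysis" "HOL-Analysis.Finite_Function_Topology"
begin

section \<open>Normalized volume with respect to the integer lattice\<close>

text \<open>
  Real vectors with finitely many nonzero coordinates are represented by
  \<open>'a \<Rightarrow>\<^sub>0 real\<close>; this makes the library's \<open>affine hull\<close> and linear independence available
  although the index set of the coordinates depends on a term.
\<close>

definition integer_points :: "('a \<Rightarrow>\<^sub>0 real) set" where
  "integer_points = {x. \<forall>a. Poly_Mapping.lookup x a \<in> \<int>}"

definition affine_coords ::
  "nat \<Rightarrow> ('a \<Rightarrow>\<^sub>0 real) \<Rightarrow> (nat \<Rightarrow> 'a \<Rightarrow>\<^sub>0 real) \<Rightarrow> (nat \<Rightarrow> real) \<Rightarrow> ('a \<Rightarrow>\<^sub>0 real)" where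
  "affine_coords d p v x = p + (\<Sum>k<d. x k *\<^sub>R v k)"

text \<open>
  An origin \<open>p\<close> and linearly independent vectors \<open>v 0, \<dots>, v (d - 1)\<close> which parametrize the
  affine hull of \<open>P\<close> over the reals, and its set of integer points over the integers.
\<close>

definition lattice_frame ::
  "('a \<Rightarrow>\<^sub>0 real) set \<Rightarrow> nat \<Rightarrow> ('a \<Rightarrow>\<^sub>0 real) \<Rightarrow> (nat \<Rightarrow> 'a \<Rightarrow>\<^sub>0 real) \<Rightarrow> bool" where
  "lattice_frame P d p v \<longleftrightarrow>
     inj_on v {..<d} \<and> independent (v ` {..<d}) \<and>
     affine hull P = range (affine_coords d p v) \<and>
     affine hull P \<inter> integer_points =
       range (\<lambda>c :: nat \<Rightarrow> int. affine_coords d p v (\<lambda>k. of_int (c k)))"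

text \<open>
  The factor \<open>fact d\<close> gives a unimodular simplex volume 1. Two lattice frames of the same
  set differ by a unimodular affine transformation of the coordinates, so the value does not
  depend on the frame.
\<close>

definition normalized_volume :: "('a \<Rightarrow>\<^sub>0 real) set \<Rightarrow> real" where
  "normalized_volume P =
     (THE r. \<exists>d p v. lattice_frame P d p v \<and>
        r = fact d * measure (\<Pi>\<^sub>M k\<in>{..<d}. lborel)
              {x \<in> {..<d} \<rightarrow>\<^sub>E UNIV. affine_coords d p v x \<in> P})"


section \<open>Multigraphs on totally ordered vertices and flow polytopes\<close>

definition multigraph_on :: "'v::linorder set \<Rightarrow> ('v \<times> 'v) multiset \<Rightarrow> bool" where
  "multigraph_on V E \<longleftrightarrow> (\<forall>(i, j)\<in>#E. i \<in> V \<and> j \<in> V \<and> i < j)"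

text \<open>Parallel edges are told apart by an index below their multiplicity.\<close>

definition edges :: "('v \<times> 'v) multiset \<Rightarrow> (('v \<times> 'v) \<times> nat) set" where
  "edges E = {(e, k). k < count E e}"

definition outflow :: "('v \<times> 'v) multiset \<Rightarrow> (('v \<times> 'v) \<times> nat \<Rightarrow>\<^sub>0 real) \<Rightarrow> 'v \<Rightarrow> real" where
  "outflow E f u = (\<Sum>a \<in> {a \<in> edges E. fst (fst a) = u}. Poly_Mapping.lookup f a)"

definition inflow :: "('v \<times> 'v) multiset \<Rightarrow> (('v \<times> 'v) \<times> nat \<Rightarrow>\<^sub>0 real) \<Rightarrow> 'v \<Rightarrow> real" where
  "inflow E f u = (\<Sum>a \<in> {a \<in> edges E. snd (fst a) = u}. Poly_Mapping.lookup f a)"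

definition flow_polytope ::
  "'v::linorder set \<Rightarrow> ('v \<times> 'v) multiset \<Rightarrow> (('v \<times> 'v) \<times> nat \<Rightarrow>\<^sub>0 real) set" where
  "flow_polytope V E =
     {f. Poly_Mapping.keys f \<subseteq> edges E \<and> (\<forall>a\<in>edges E. 0 \<le> Poly_Mapping.lookup f a) \<and>
         outflow E f (Min V) = 1 \<and> inflow E f (Max V) = 1 \<and>
         (\<forall>u \<in> V - {Min V, Max V}. inflow E f u = outflow E f u)}"

definition restrict_graph :: "(nat \<times> nat) multiset \<Rightarrow> nat \<Rightarrow> (nat \<times> nat) multiset" where
  "restrict_graph E i = filter_mset (\<lambda>(a, b). a \<in> {1..i} \<and> b \<in> {1..i}) E"

text \<open>For a graph on \<open>{1..n + 1}\<close>, the new vertices \<open>s\<close> and \<open>t\<close> are \<open>0\<close> and \<open>n + 2\<close>.\<close>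

definition tilde_vertices :: "nat \<Rightarrow> nat set" where
  "tilde_vertices n = insert 0 (insert (n + 2) {1..n + 1})"

definition tilde_edges :: "nat \<Rightarrow> (nat \<times> nat) multiset \<Rightarrow> (nat \<times> nat) multiset" where
  "tilde_edges n E =
     E + mset_set ((\<lambda>i. (0, i)) ` {1..n + 1}) + mset_set ((\<lambda>i. (i, n + 2)) ` {1..n + 1})"


section \<open>Triangular arrays\<close>

definition triangle :: "nat \<Rightarrow> (nat \<times> nat) set" where
  "triangle n = {(i, j). j \<in> {1..n - 1} \<and> i \<in> {j + 1..n}}"

definition graph_arrays :: "nat \<Rightarrow> (nat \<times> nat) multiset \<Rightarrow> (nat \<times> nat \<Rightarrow> nat) set" where
  "graph_arrays n E =
     {b \<in> triangle n \<rightarrow>\<^sub>E UNIV.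
        (\<forall>i\<in>{1..n - 1}.
           (\<Sum>k\<in>{i + 1..n}. int (b (k, i)))
             \<le> int (size (restrict_graph E (i + 1))) - int (size (restrict_graph E i))
                + (\<Sum>k\<in>{1..<i}. int (b (i, k)))) \<and>
        (\<forall>i j. 1 \<le> i \<and> i < j \<and> j \<le> n \<and> (i + 1, j + 1) \<notin># E \<longrightarrow> b (j, i) = 0)}"

end

theory Submission
  imports Defs "HOL-Probability.Distributions"
begin

text \<open>
  Let \<open>H\<close> be the graph with the extra vertices \<open>s = 0\<close> and \<open>t = n + 2\<close>. A flow on \<open>H\<close> is determined by
  its values on the arcs that do not end in \<open>t\<close>; on these arcs it has to be nonnegative, and no inner
  vertex may send out more than it receives. Dropping the condition that the total outflow of \<open>s\<close> is
  \<open>1\<close> gives a cone. With this outflow as the height, the polytope is the slice of the cone at height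
  \<open>1\<close>. If the slice has dimension \<open>d\<close>, then
  the integral of \<open>exp (- height)\<close> over the cone is the volume of the slice times the integral of
  \<open>r ^ d * exp (- r)\<close> over \<open>r \<ge> 0\<close>, which is \<open>fact d\<close>. So this integral is the normalized volume
  (\<open>emeasure_flow_cone_slice\<close>, \<open>normalized_volume_network_flows\<close>).

  The integral over the cone counts integer flows, for a reason that is best seen in terms of
  independent standard exponential variables. Give the arcs out of \<open>s\<close> such values. If the arcs into a
  vertex carry independent Gamma variables of shapes \<open>m + 1\<close>, for integers \<open>m\<close>, their sum is a Gamma
  variable whose shape \<open>p\<close> is the sum of all \<open>m + 1\<close>. As a function of the flows on the outgoing arcs
  that add up to this variable, its density is a sum of products of Gamma densities, one product of
  densities of shapes \<open>m + 1\<close> for every way to write \<open>p - 1\<close> as a sum of integers \<open>m \<ge> 0\<close> over these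
  arcs. The integral over all arcs is therefore the number of ways to send
  integers through the network when each vertex passes on, apart from what goes to \<open>t\<close>, at most the sum
  of what it receives and of a bonus of one for each incoming arc, minus one. Two facts about the tail
  of a Gamma distribution, \<open>gamma_tail_convolution\<close> and \<open>gamma_tail_add\<close>, allow one arc at a time to be
  eliminated, always one that leaves a vertex without incoming arcs; both the integral and the number
  of integer flows satisfy the resulting recursion (\<open>nn_integral_network_weight\<close>).

  The normalized volume refers to any parametrization of the affine hull that matches its integer
  points. Two of them differ by a unimodular affine map \<open>f\<close>. Such maps preserve the measure: by
  translation invariance they scale it by a constant, and the constant is \<open>1\<close> because the preimage of a
  unit cube under \<open>f\<close> tiles the space under integer translations, just as the cube does
  (\<open>emeasure_unimodular_preimage\<close>, \<open>normalized_volume_eqI\<close>).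

  In the integer flows that are counted, vertex \<open>1\<close> has nothing to pass on: its only incoming arc comes
  from \<open>s\<close>, whose arcs carry \<open>0\<close>. So every arc out of \<open>1\<close> carries \<open>0\<close>, and what remains is a flow on the
  simple edges between the vertices \<open>2, \<dots>, n + 1\<close>. Written as an array whose entry at \<open>(j, i)\<close> is the
  flow from \<open>i + 1\<close> to \<open>j + 1\<close>, the conditions on the flow are those on the array (\<open>card_flows\<close>).
\<close>

section \<open>Gamma densities and their tails\<close>

text \<open>
  These are the density at \<open>x \<ge> 0\<close> of the Gamma distribution of shape \<open>m + 1\<close> and rate \<open>1\<close>, and the
  probability that the sum of \<open>k\<close> independent standard exponential variables is at least \<open>s\<close>. For
  \<open>k = 0\<close> the latter is the indicator function of \<open>s \<le> 0\<close>.
\<close>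

definition gamma_density :: "nat \<Rightarrow> real \<Rightarrow> real" where
  "gamma_density m x = x ^ m / fact m * exp (- x)"

definition gamma_tail :: "nat \<Rightarrow> real \<Rightarrow> real" where
  "gamma_tail k s = (if s \<le> 0 then 1 else exp (- s) * (\<Sum>j<k. s ^ j / fact j))"

lemma gamma_density_nonneg: "0 \<le> x \<Longrightarrow> 0 \<le> gamma_density m x"
  by (simp add: gamma_density_def)

lemma gamma_tail_nonneg: "0 \<le> gamma_tail k s"
  by (auto simp: gamma_tail_def intro!: sum_nonneg mult_nonneg_nonneg)

lemma borel_measurable_gamma_density [measurable]: "gamma_density m \<in> borel_measurable borel"
  unfolding gamma_density_def[abs_def] by measurable

lemma borel_measurable_gamma_tail [measurable]: "gamma_tail k \<in> borel_measurable borel"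
  unfolding gamma_tail_def[abs_def] by measurable

lemma nn_integral_gamma_density:
  "(\<integral>\<^sup>+x. ennreal (gamma_density m x) * indicator {0..} x \<partial>lborel) = 1"
proof -
  have "(\<integral>\<^sup>+x. ennreal (gamma_density m x) * indicator {0..} x \<partial>lborel)
      = (\<integral>\<^sup>+x. ennreal (1 / fact m) * (ennreal (x ^ m * exp (- x)) * indicator {0..} x) \<partial>lborel)"
    by (intro nn_integral_cong)
       (auto simp: gamma_density_def ennreal_mult[symmetric] split: split_indicator)
  also have "\<dots> = ennreal (1 / fact m) * ennreal (real (fact m))"
    by (subst nn_integral_cmult) (auto simp: nn_intergal_power_times_exp_Ici)
  also have "\<dots> = 1"
    by (simp add: ennreal_mult[symmetric])
  finally show ?thesis .
qed

text \<open>
  Integration by parts lowers \<open>m\<close> and raises \<open>j\<close> by one, and the boundary terms vanish at \<open>0\<close> and \<open>s\<close>.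
\<close>

lemma beta_antiderivative:
  fixes s :: real
  shows "\<exists>F. (\<forall>x. (F has_real_derivative x ^ m / fact m * ((s - x) ^ j / fact j)) (at x)) \<and>
             F s - F 0 = s ^ (m + j + 1) / fact (m + j + 1)"
proof (induction m arbitrary: j)
  case 0
  have "((\<lambda>x. - ((s - x) ^ (j + 1) / fact (j + 1))) has_real_derivative
          x ^ 0 / fact 0 * ((s - x) ^ j / fact j)) (at x)" for x
    by (rule derivative_eq_intros refl | simp del: of_nat_Suc)+
  then show ?case
    by (intro exI[of _ "\<lambda>x. - ((s - x) ^ (j + 1) / fact (j + 1))"]) auto
next
  case (Suc m)
  obtain F where F: "\<And>x. (F has_real_derivative x ^ m / fact m * ((s - x) ^ (j + 1) / fact (j + 1))) (at x)"
    "F s - F 0 = s ^ (m + (j + 1) + 1) / fact (m + (j + 1) + 1)"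
    using Suc[of "j + 1"] by blast
  define P where "P = (\<lambda>x. x ^ Suc m / fact (Suc m) :: real)"
  define Q where "Q = (\<lambda>x. (s - x) ^ (j + 1) / fact (j + 1) :: real)"
  have P: "(P has_real_derivative x ^ m / fact m) (at x)" for x
    unfolding P_def by (rule derivative_eq_intros refl | simp)+
  have Q: "(Q has_real_derivative - ((s - x) ^ j / fact j)) (at x)" for x
    unfolding Q_def by (rule derivative_eq_intros refl | simp del: of_nat_Suc)+
  have "((\<lambda>x. F x - P x * Q x) has_real_derivative P x * ((s - x) ^ j / fact j)) (at x)" for x
    by (rule derivative_eq_intros F(1) P Q refl)+ (simp add: Q_def)
  moreover have "F s - P s * Q s - (F 0 - P 0 * Q 0) = s ^ (Suc m + j + 1) / fact (Suc m + j + 1)"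
    using F(2) by (simp add: P_def Q_def)
  ultimately show ?case
    unfolding P_def Q_def by (intro exI[of _ "\<lambda>x. F x - P x * Q x"]) (auto simp: P_def Q_def)
qed

lemma nn_integral_beta:
  assumes "0 \<le> s"
  shows "(\<integral>\<^sup>+x. ennreal (x ^ m / fact m * ((s - x) ^ j / fact j)) * indicator {0..s} x \<partial>lborel)
           = ennreal (s ^ (m + j + 1) / fact (m + j + 1))"
proof -
  obtain F where F: "\<And>x. (F has_real_derivative x ^ m / fact m * ((s - x) ^ j / fact j)) (at x)"
    "F s - F 0 = s ^ (m + j + 1) / fact (m + j + 1)"
    using beta_antiderivative[of m s j] by blast
  show ?thesis
    by (subst nn_integral_FTC_Icc[where F = F])
       (use F assms in \<open>auto intro: has_field_derivative_subset\<close>)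
qed

text \<open>
  An independent Gamma variable of shape \<open>m + 1\<close> added to one of shape \<open>k\<close> gives one of shape
  \<open>k + m + 1\<close>. Values \<open>x > s\<close> contribute the tail of the added variable alone; for \<open>x < s\<close> each term of
  the tail of the other variable gives a Beta integral.
\<close>

lemma gamma_tail_convolution:
  "(\<integral>\<^sup>+x. ennreal (gamma_density m x * gamma_tail k (s - x)) * indicator {0..} x \<partial>lborel)
     = ennreal (gamma_tail (k + m + 1) s)"
proof (cases "s \<le> 0")
  case True
  then have "(\<integral>\<^sup>+x. ennreal (gamma_density m x * gamma_tail k (s - x)) * indicator {0..} x \<partial>lborel)
      = (\<integral>\<^sup>+x. ennreal (gamma_density m x) * indicator {0..} x \<partial>lborel)"
    by (intro nn_integral_cong) (auto simp: gamma_tail_def split: split_indicator)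
  then show ?thesis
    using True by (simp add: nn_integral_gamma_density gamma_tail_def)
next
  case False
  then have s: "0 < s" by simp
  have split: "ennreal (gamma_density m x * gamma_tail k (s - x)) * indicator {0..} x
      = (\<Sum>j<k. ennreal (exp (- s)) *
            (ennreal (x ^ m / fact m * ((s - x) ^ j / fact j)) * indicator {0..s} x))
          + ennreal (gamma_density m x) * indicator {s..} x"
    if x: "x \<noteq> s" for x
  proof -
    consider "x < 0" | "0 \<le> x" "x < s" | "s < x" using x by linarith
    then show ?thesis
    proof cases
      case 2
      have "gamma_density m x * gamma_tail k (s - x)
          = (\<Sum>j<k. exp (- s) * (x ^ m / fact m * ((s - x) ^ j / fact j)))"
        using 2 by (simp add: gamma_density_def gamma_tail_def sum_distrib_left exp_diff
            exp_minus field_simps)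
      then show ?thesis
        using 2 by (simp add: sum_nonneg ennreal_mult[symmetric])
    qed (use s in \<open>auto simp: gamma_tail_def\<close>)
  qed
  have tail: "(\<integral>\<^sup>+x. ennreal (gamma_density m x) * indicator {s..} x \<partial>lborel)
      = ennreal (gamma_tail (m + 1) s)"
  proof -
    let ?A = "\<integral>\<^sup>+x. ennreal (gamma_density m x) * indicator {0..s} x \<partial>lborel"
    let ?B = "\<integral>\<^sup>+x. ennreal (gamma_density m x) * indicator {s..} x \<partial>lborel"
    have "1 = (\<integral>\<^sup>+x. ennreal (gamma_density m x) * indicator {0..} x \<partial>lborel)"
      by (rule nn_integral_gamma_density[symmetric])
    also have "\<dots> = (\<integral>\<^sup>+x. ennreal (gamma_density m x) * indicator {0..s} x
        + ennreal (gamma_density m x) * indicator {s..} x \<partial>lborel)"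
    proof (rule nn_integral_cong_AE, rule AE_mp[OF AE_lborel_singleton[of s]], rule AE_I2, rule impI)
      fix x :: real assume "x \<noteq> s"
      then consider "x < 0" | "0 \<le> x" "x < s" | "s < x" by linarith
      then show "ennreal (gamma_density m x) * indicator {0..} x
          = ennreal (gamma_density m x) * indicator {0..s} x
            + ennreal (gamma_density m x) * indicator {s..} x"
        by cases (use s in auto)
    qed
    also have "\<dots> = ?A + ?B"
      by (rule nn_integral_add) auto
    finally have sum: "?A + ?B = 1" ..
    have "?A = (\<integral>\<^sup>+x. ennreal (1 / fact m) * (ennreal (x ^ m * exp (- x)) * indicator {0..s} x) \<partial>lborel)"
      by (intro nn_integral_cong)
         (auto simp: gamma_density_def ennreal_mult[symmetric] split: split_indicator)
    also have "\<dots> = ennreal (1 / fact m) * ennreal ((1 - (\<Sum>n\<le>m. (s ^ n * exp (- s)) / fact n)) * fact m)"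
      using s by (subst nn_integral_cmult) (auto simp: nn_intergal_power_times_exp_Icc)
    also have "\<dots> = ennreal (1 - gamma_tail (m + 1) s)"
      using s by (subst ennreal_mult'[symmetric])
        (auto simp: gamma_tail_def sum_distrib_left lessThan_Suc_atMost mult_ac)
    finally have A: "?A = ennreal (1 - gamma_tail (m + 1) s)" .
    \<comment> \<open>A partial sum of the exponential series is at most its limit, so the subtraction is not truncated.\<close>
    have "(\<Sum>j<m + 1. s ^ j / fact j) \<le> exp s"
      using sum_le_suminf[OF summable_exp_generic[of s], of "{..<m + 1}"] s
      by (auto simp: exp_def divide_inverse mult_ac)
    then have "exp (- s) * (\<Sum>j<m + 1. s ^ j / fact j) \<le> exp (- s) * exp s"
      by (intro mult_left_mono) auto
    then have le1: "gamma_tail (m + 1) s \<le> 1"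
      using s by (simp add: gamma_tail_def exp_minus)
    have "ennreal (1 - gamma_tail (m + 1) s) + ?B
        = ennreal (1 - gamma_tail (m + 1) s) + ennreal (gamma_tail (m + 1) s)"
      using sum le1 gamma_tail_nonneg[of "m + 1" s] unfolding A
      by (simp add: ennreal_plus[symmetric] del: ennreal_plus)
    then show ?thesis by (simp add: ennreal_add_left_cancel)
  qed
  have "(\<integral>\<^sup>+x. ennreal (gamma_density m x * gamma_tail k (s - x)) * indicator {0..} x \<partial>lborel)
      = (\<integral>\<^sup>+x. (\<Sum>j<k. ennreal (exp (- s)) *
            (ennreal (x ^ m / fact m * ((s - x) ^ j / fact j)) * indicator {0..s} x))
          + ennreal (gamma_density m x) * indicator {s..} x \<partial>lborel)"
    by (rule nn_integral_cong_AE, rule AE_mp[OF AE_lborel_singleton[of s]], rule AE_I2)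
       (use split in blast)
  also have "\<dots> = (\<Sum>j<k. ennreal (exp (- s)) * ennreal (s ^ (m + j + 1) / fact (m + j + 1)))
      + ennreal (gamma_tail (m + 1) s)"
    using s
    by (subst nn_integral_add, simp, simp, subst nn_integral_sum, simp, subst nn_integral_cmult, simp)
       (simp only: nn_integral_beta less_imp_le tail)
  also have "\<dots> = ennreal ((\<Sum>j<k. exp (- s) * (s ^ (m + j + 1) / fact (m + j + 1)))
      + gamma_tail (m + 1) s)"
    using s by (simp add: ennreal_mult[symmetric] sum_nonneg gamma_tail_nonneg del: fact_Suc)
  also have "(\<Sum>j<k. exp (- s) * (s ^ (m + j + 1) / fact (m + j + 1))) + gamma_tail (m + 1) s
      = gamma_tail (k + m + 1) s"
  proof -
    have "(\<Sum>j<k + (m + 1). s ^ j / fact j)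
        = (\<Sum>j<m + 1. s ^ j / fact j) + (\<Sum>j<k. s ^ (m + j + 1) / fact (m + j + 1))"
      by (induction k) (simp_all add: add_ac del: fact_Suc)
    moreover have "(\<Sum>j<k. exp (- s) * (s ^ (m + j + 1) / fact (m + j + 1)))
        = exp (- s) * (\<Sum>j<k. s ^ (m + j + 1) / fact (m + j + 1))"
      by (rule sum_distrib_left[symmetric])
    ultimately show ?thesis
      using s by (simp only: gamma_tail_def add.assoc distrib_left) simp
  qed
  finally show ?thesis .
qed

text \<open>
  In a Poisson process, the two sides are the probability of fewer than \<open>k\<close> events in a period of length
  \<open>x + s\<close>; on the right it is split according to the number \<open>m\<close> of events in the first part.
\<close>

lemma gamma_tail_add:
  assumes "1 \<le> k" "0 \<le> x" "0 \<le> s"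
  shows "gamma_tail k (x + s) = (\<Sum>m<k. gamma_density m x * gamma_tail (k - m) s)"
proof -
  have tail: "gamma_tail i t = exp (- t) * (\<Sum>j<i. t ^ j / fact j)" if "1 \<le> i" "0 \<le> t" for i t
  proof (cases "t = 0")
    case True
    have "(\<Sum>j<i. (0::real) ^ j / fact j) = (\<Sum>j\<in>{0}. 0 ^ j / fact j)"
      using that by (intro sum.mono_neutral_right) auto
    with True show ?thesis by (simp add: gamma_tail_def)
  qed (use that in \<open>simp add: gamma_tail_def\<close>)
  have "(x + s) ^ l / fact l = (\<Sum>m\<le>l. x ^ m / fact m * (s ^ (l - m) / fact (l - m)))" for l
    using exp_series_add_commuting[of x s l] by (simp add: divide_inverse mult.commute)
  then have "(\<Sum>l<k. (x + s) ^ l / fact l)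
      = (\<Sum>l<k. \<Sum>m\<le>l. x ^ m / fact m * (s ^ (l - m) / fact (l - m)))"
    by simp
  also have "\<dots> = (\<Sum>(m, j)\<in>{(m, j). m + j < k}. x ^ m / fact m * (s ^ j / fact j))"
    by (rule sum.triangle_reindex[symmetric])
  also have "{(m, j). m + j < k} = (SIGMA m:{..<k}. {..<k - m})"
    by auto
  also have "(\<Sum>(m, j)\<in>\<dots>. x ^ m / fact m * (s ^ j / fact j))
      = (\<Sum>m<k. x ^ m / fact m * (\<Sum>j<k - m. s ^ j / fact j))"
    by (subst sum.Sigma[symmetric]) (auto simp: sum_distrib_left)
  finally have "gamma_tail k (x + s)
      = (\<Sum>m<k. exp (- (x + s)) * (x ^ m / fact m * (\<Sum>j<k - m. s ^ j / fact j)))"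
    using assms by (simp add: tail sum_distrib_left)
  also have "\<dots> = (\<Sum>m<k. gamma_density m x * gamma_tail (k - m) s)"
    using assms by (intro sum.cong) (auto simp: tail gamma_density_def mult_exp_exp)
  finally show ?thesis .
qed

section \<open>Integer flows in an acyclic network as an integral\<close>

text \<open>
  An acyclic network is given by functions from arcs to natural numbers for the initial and the
  final vertices. With the first of these as \<open>e\<close>, \<open>arc_sum e A g u\<close> is the flow out of \<open>u\<close>; with the
  second it is the flow into \<open>u\<close>.
\<close>

definition arc_sum :: "('a \<Rightarrow> nat) \<Rightarrow> 'a set \<Rightarrow> ('a \<Rightarrow> 'b::comm_monoid_add) \<Rightarrow> nat \<Rightarrow> 'b" where
  "arc_sum e A g u = (\<Sum>a\<in>{a \<in> A. e a = u}. g a)"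

lemma arc_sum_empty [simp]: "arc_sum src {} g u = 0"
  by (simp add: arc_sum_def)

lemma arc_sum_insert:
  assumes "finite A" "a \<notin> A"
  shows "arc_sum src (insert a A) g u = (if src a = u then g a else 0) + arc_sum src A g u"
proof -
  have "{x \<in> insert a A. src x = u} = (if src a = u then {a} else {}) \<union> {x \<in> A. src x = u}"
    by auto
  then show ?thesis using assms by (auto simp: arc_sum_def)
qed

lemma arc_sum_cong: "(\<And>a. a \<in> A \<Longrightarrow> g a = g' a) \<Longrightarrow> arc_sum src A g u = arc_sum src A g' u"
  by (auto simp: arc_sum_def intro!: sum.cong)

lemma arc_sum_nonneg:
  fixes g :: "'a \<Rightarrow> real"
  shows "(\<And>a. a \<in> A \<Longrightarrow> 0 \<le> g a) \<Longrightarrow> 0 \<le> arc_sum src A g u"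
  by (auto simp: arc_sum_def intro!: sum_nonneg)

lemma arc_sum_fun_upd [simp]: "a \<notin> A \<Longrightarrow> arc_sum src A (g(a := y)) u = arc_sum src A g u"
  by (rule arc_sum_cong) auto

lemma borel_measurable_arc_sum [measurable]:
  "(\<lambda>x. arc_sum src A x u) \<in> borel_measurable (\<Pi>\<^sub>M a\<in>A. (lborel :: real measure))"
  unfolding arc_sum_def by (intro borel_measurable_sum) measurable

text \<open>
  Each arc into \<open>u\<close> contributes its own flow and one unit more to what \<open>u\<close> may send out. The extra
  supply \<open>k\<close> keeps track of the contributions of arcs that have already been eliminated.
\<close>

definition network_flows ::
  "('a \<Rightarrow> nat) \<Rightarrow> ('a \<Rightarrow> nat) \<Rightarrow> nat set \<Rightarrow> 'a set \<Rightarrow> (nat \<Rightarrow> nat) \<Rightarrow> ('a \<Rightarrow> nat) set" where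
  "network_flows src tgt V A k =
     {g \<in> A \<rightarrow>\<^sub>E UNIV. \<forall>u\<in>V.
        arc_sum src A g u < k u + card {a \<in> A. tgt a = u} + arc_sum tgt A g u}"

text \<open>
  If nothing enters the initial vertex of \<open>a\<close>, then the flow \<open>m\<close> on \<open>a\<close> is below the supply of that
  vertex. Deleting \<open>a\<close> uses up \<open>m\<close> of this supply and leaves \<open>m + 1\<close> at the final vertex.
\<close>

lemma network_flows_insert:
  assumes A: "finite A" "a \<notin> A"
    and V: "src a \<in> V" "tgt a \<in> V" "src a \<noteq> tgt a"
    and source: "\<And>b. b \<in> A \<Longrightarrow> tgt b \<noteq> src a"
  shows "network_flows src tgt V (insert a A) k =
           (\<Union>m<k (src a). (\<lambda>g. g(a := m)) ` network_flows src tgt V A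
              (k(src a := k (src a) - m, tgt a := k (tgt a) + m + 1)))"
    (is "?L = (\<Union>m<_. _ ` network_flows _ _ _ _ (?k m))")
proof -
  have in_a: "arc_sum tgt A g (src a) = 0" for g :: "'a \<Rightarrow> nat"
    using source by (auto simp: arc_sum_def intro!: sum.neutral)
  have in_card_a: "{b \<in> A. tgt b = src a} = {}"
    using source by auto
  have indeg: "card {b \<in> insert a A. tgt b = u} = (if tgt a = u then 1 else 0) + card {b \<in> A. tgt b = u}" for u
  proof -
    have "{b \<in> insert a A. tgt b = u} = (if tgt a = u then {a} else {}) \<union> {b \<in> A. tgt b = u}"
      by auto
    then show ?thesis using A by auto
  qed
  have eq: "(\<forall>u\<in>V. arc_sum src (insert a A) (g(a := m)) u
          < k u + card {b \<in> insert a A. tgt b = u} + arc_sum tgt (insert a A) (g(a := m)) u)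
      \<longleftrightarrow> m < k (src a) \<and> (\<forall>u\<in>V. arc_sum src A g u
          < ?k m u + card {b \<in> A. tgt b = u} + arc_sum tgt A g u)" for g m
  proof -
    have "(arc_sum src (insert a A) (g(a := m)) u
          < k u + card {b \<in> insert a A. tgt b = u} + arc_sum tgt (insert a A) (g(a := m)) u)
      \<longleftrightarrow> (arc_sum src A g u < ?k m u + card {b \<in> A. tgt b = u} + arc_sum tgt A g u)"
      if "m < k (src a)" for u
      unfolding indeg arc_sum_insert[OF A] using A V that by (auto simp: in_a in_card_a)
    moreover have "m < k (src a)" if "\<forall>u\<in>V. arc_sum src (insert a A) (g(a := m)) u
          < k u + card {b \<in> insert a A. tgt b = u} + arc_sum tgt (insert a A) (g(a := m)) u"
      using that[rule_format, OF V(1)] A V unfolding indeg arc_sum_insert[OF A]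
      by (auto simp: in_a in_card_a)
    ultimately show ?thesis by blast
  qed
  show ?thesis
  proof (intro equalityI subsetI)
    fix g assume g: "g \<in> ?L"
    define g' where "g' = g(a := undefined)"
    have g_eq: "g = g'(a := g a)" by (simp add: g'_def)
    have ext: "g' \<in> A \<rightarrow>\<^sub>E UNIV"
      using g A by (auto simp: g'_def network_flows_def PiE_def extensional_def)
    have "\<forall>u\<in>V. arc_sum src (insert a A) (g'(a := g a)) u
          < k u + card {b \<in> insert a A. tgt b = u} + arc_sum tgt (insert a A) (g'(a := g a)) u"
      using g unfolding network_flows_def g_eq[symmetric] by blast
    with eq have "g a < k (src a)" "g' \<in> network_flows src tgt V A (?k (g a))"
      using ext by (auto simp: network_flows_def)
    then show "g \<in> (\<Union>m<k (src a). (\<lambda>g. g(a := m)) ` network_flows src tgt V A (?k m))"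
      using g_eq by blast
  next
    fix g assume "g \<in> (\<Union>m<k (src a). (\<lambda>g. g(a := m)) ` network_flows src tgt V A (?k m))"
    then obtain m g' where m: "m < k (src a)" and g': "g' \<in> network_flows src tgt V A (?k m)"
      and g_eq: "g = g'(a := m)" by auto
    have "g \<in> insert a A \<rightarrow>\<^sub>E UNIV"
      using g' unfolding g_eq network_flows_def by (auto simp: PiE_def extensional_def)
    moreover have "\<forall>u\<in>V. arc_sum src (insert a A) g u
          < k u + card {b \<in> insert a A. tgt b = u} + arc_sum tgt (insert a A) g u"
      using g' m unfolding g_eq eq by (auto simp: network_flows_def)
    ultimately show "g \<in> ?L" by (simp add: network_flows_def)
  qed
qed

lemma card_network_flows_insert:
  assumes A: "finite A" "a \<notin> A"
    and V: "src a \<in> V" "tgt a \<in> V" "src a \<noteq> tgt a"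
    and source: "\<And>b. b \<in> A \<Longrightarrow> tgt b \<noteq> src a"
    and fin: "\<And>m. m < k (src a) \<Longrightarrow> finite (network_flows src tgt V A
              (k(src a := k (src a) - m, tgt a := k (tgt a) + m + 1)))"
  shows "finite (network_flows src tgt V (insert a A) k)"
    and "card (network_flows src tgt V (insert a A) k) =
           (\<Sum>m<k (src a). card (network_flows src tgt V A
              (k(src a := k (src a) - m, tgt a := k (tgt a) + m + 1))))"
proof -
  let ?F = "\<lambda>m. network_flows src tgt V A (k(src a := k (src a) - m, tgt a := k (tgt a) + m + 1))"
  have eq: "network_flows src tgt V (insert a A) k = (\<Union>m<k (src a). (\<lambda>g. g(a := m)) ` ?F m)"
    by (rule network_flows_insert[where src = src and tgt = tgt, OF A V]) (rule source)
  show "finite (network_flows src tgt V (insert a A) k)"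
    unfolding eq by (intro finite_UN_I finite_imageI fin) auto
  have inj: "inj_on (\<lambda>g. g(a := m)) (?F m)" for m
  proof (rule inj_onI)
    fix g g' assume "g \<in> ?F m" "g' \<in> ?F m" and upd: "g(a := m) = g'(a := m)"
    then have "g a = g' a"
      using A by (auto simp: network_flows_def PiE_def extensional_def)
    then show "g = g'" using upd by (metis fun_upd_triv fun_upd_upd)
  qed
  have "card (network_flows src tgt V (insert a A) k)
      = (\<Sum>m<k (src a). card ((\<lambda>g. g(a := m)) ` ?F m))"
    unfolding eq
  proof (rule card_UN_disjoint)
    show "\<forall>i\<in>{..<k (src a)}. \<forall>j\<in>{..<k (src a)}. i \<noteq> j \<longrightarrow>
        (\<lambda>g. g(a := i)) ` ?F i \<inter> (\<lambda>g. g(a := j)) ` ?F j = {}"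
      by (auto dest: fun_cong[where x = a])
  qed (use fin in auto)
  also have "\<dots> = (\<Sum>m<k (src a). card (?F m))"
    by (intro sum.cong refl card_image inj)
  finally show "card (network_flows src tgt V (insert a A) k) = (\<Sum>m<k (src a). card (?F m))" .
qed

lemma split_two_factors:
  fixes f :: "'a \<Rightarrow> 'b::comm_monoid_mult"
  assumes "finite V" "i \<in> V" "j \<in> V" "i \<noteq> j"
  shows "(\<Prod>u\<in>V. f u) = f i * (f j * (\<Prod>u\<in>V - {i, j}. f u))"
proof -
  have "(\<Prod>u\<in>V. f u) = f i * (\<Prod>u\<in>V - {i}. f u)"
    using assms by (intro prod.remove) auto
  also have "(\<Prod>u\<in>V - {i}. f u) = f j * (\<Prod>u\<in>V - {i} - {j}. f u)"
    using assms by (intro prod.remove) auto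
  also have "V - {i} - {j} = V - {i, j}" by auto
  finally show ?thesis .
qed

text \<open>
  Integrating this weight over the nonnegative \<open>x\<close> gives the number of network flows. The factor of \<open>u\<close>
  is the probability that an independent supply of shape \<open>k u\<close> covers the excess of the outflow over
  the inflow.
\<close>

definition network_weight ::
  "('a \<Rightarrow> nat) \<Rightarrow> ('a \<Rightarrow> nat) \<Rightarrow> nat set \<Rightarrow> 'a set \<Rightarrow> (nat \<Rightarrow> nat) \<Rightarrow> ('a \<Rightarrow> real) \<Rightarrow> real" where
  "network_weight src tgt V A k x =
     (\<Prod>u\<in>V. gamma_tail (k u) (arc_sum src A x u - arc_sum tgt A x u))"

lemma borel_measurable_network_weight [measurable]:
  "(\<lambda>x. network_weight src tgt V A k x) \<in> borel_measurable (\<Pi>\<^sub>M a\<in>A. (lborel :: real measure))"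
  unfolding network_weight_def by (intro borel_measurable_prod) measurable

text \<open>
  Only the factors of the two ends of \<open>a\<close> depend on the value \<open>y\<close> at \<open>a\<close>. The factor of the initial
  vertex is expanded by \<open>gamma_tail_add\<close> into Gamma densities in \<open>y\<close>, and each of them is then absorbed
  by the factor of the final vertex with \<open>gamma_tail_convolution\<close>.
\<close>

lemma nn_integral_network_weight_arc:
  assumes A: "finite A" "a \<notin> A" "finite V"
    and V: "src a \<in> V" "tgt a \<in> V" "src a \<noteq> tgt a"
    and source: "\<And>b. b \<in> A \<Longrightarrow> tgt b \<noteq> src a"
    and k: "1 \<le> k (src a)"
    and x: "\<And>b. b \<in> A \<Longrightarrow> 0 \<le> x b"
  shows "(\<integral>\<^sup>+y. ennreal (network_weight src tgt V (insert a A) k (x(a := y))) * indicator {0..} y \<partial>lborel)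
    = (\<Sum>m<k (src a). ennreal (network_weight src tgt V A
         (k(src a := k (src a) - m, tgt a := k (tgt a) + m + 1)) x))"
proof -
  define i j where "i = src a" and "j = tgt a"
  define s where "s = arc_sum src A x i"
  define r where "r = arc_sum src A x j - arc_sum tgt A x j"
  define c where "c = (\<Prod>u\<in>V - {i, j}. gamma_tail (k u) (arc_sum src A x u - arc_sum tgt A x u))"
  have ij: "i \<in> V" "j \<in> V" "i \<noteq> j" using V by (auto simp: i_def j_def)
  have c0: "0 \<le> c" unfolding c_def by (intro prod_nonneg) (auto simp: gamma_tail_nonneg)
  have s0: "0 \<le> s" unfolding s_def by (rule arc_sum_nonneg) (rule x)
  have in_i: "arc_sum tgt A x i = 0"
    using source by (auto simp: arc_sum_def i_def intro!: sum.neutral)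
  have weight: "network_weight src tgt V A (k(i := l, j := l')) x = gamma_tail l s * (gamma_tail l' r * c)" for l l'
  proof -
    have "(\<Prod>u\<in>V - {i, j}. gamma_tail ((k(i := l, j := l')) u) (arc_sum src A x u - arc_sum tgt A x u)) = c"
      unfolding c_def by (intro prod.cong) auto
    then show ?thesis
      unfolding network_weight_def
      by (subst split_two_factors[OF A(3) ij]) (use ij in \<open>simp add: s_def r_def in_i\<close>)
  qed
  have weight_a: "network_weight src tgt V (insert a A) k (x(a := y))
      = (\<Sum>m<k i. gamma_density m y * gamma_tail (k j) (r - y) * (gamma_tail (k i - m) s * c))"
    if "0 \<le> y" for y
  proof -
    have "(\<Prod>u\<in>V - {i, j}. gamma_tail (k u)
        (arc_sum src (insert a A) (x(a := y)) u - arc_sum tgt (insert a A) (x(a := y)) u)) = c"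
      unfolding c_def using A by (intro prod.cong) (auto simp: arc_sum_insert i_def j_def)
    then have "network_weight src tgt V (insert a A) k (x(a := y))
        = gamma_tail (k i) (y + s) * (gamma_tail (k j) (r - y) * c)"
      unfolding network_weight_def
      by (subst split_two_factors[OF A(3) ij])
         (use ij A in \<open>simp add: arc_sum_insert s_def r_def in_i flip: i_def j_def, simp add: algebra_simps\<close>)
    also have "gamma_tail (k i) (y + s) = (\<Sum>m<k i. gamma_density m y * gamma_tail (k i - m) s)"
      using k s0 that by (intro gamma_tail_add) (auto simp: i_def)
    also have "\<dots> * (gamma_tail (k j) (r - y) * c)
        = (\<Sum>m<k i. gamma_density m y * gamma_tail (k j) (r - y) * (gamma_tail (k i - m) s * c))"
      unfolding sum_distrib_right by (intro sum.cong refl) (simp only: mult_ac)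
    finally show ?thesis .
  qed
  have "(\<integral>\<^sup>+y. ennreal (network_weight src tgt V (insert a A) k (x(a := y))) * indicator {0..} y \<partial>lborel)
    = (\<integral>\<^sup>+y. (\<Sum>m<k i. (ennreal (gamma_density m y * gamma_tail (k j) (r - y)) * indicator {0..} y)
            * ennreal (gamma_tail (k i - m) s * c)) \<partial>lborel)"
  proof (rule nn_integral_cong)
    fix y :: real
    show "ennreal (network_weight src tgt V (insert a A) k (x(a := y))) * indicator {0..} y
        = (\<Sum>m<k i. (ennreal (gamma_density m y * gamma_tail (k j) (r - y)) * indicator {0..} y)
            * ennreal (gamma_tail (k i - m) s * c))"
    proof (cases "0 \<le> y")
      case True
      then have "ennreal (network_weight src tgt V (insert a A) k (x(a := y)))
          = (\<Sum>m<k i. ennreal (gamma_density m y * gamma_tail (k j) (r - y) * (gamma_tail (k i - m) s * c)))"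
        using c0 by (simp add: weight_a gamma_density_nonneg gamma_tail_nonneg)
      with True c0 show ?thesis
        by (simp add: ennreal_mult gamma_density_nonneg gamma_tail_nonneg)
    qed simp
  qed
  also have "\<dots> = (\<Sum>m<k i. ennreal (gamma_tail (k j + m + 1) r) * ennreal (gamma_tail (k i - m) s * c))"
    by (subst nn_integral_sum, simp, subst nn_integral_multc, simp) (simp only: gamma_tail_convolution)
  also have "\<dots> = (\<Sum>m<k i. ennreal (network_weight src tgt V A (k(i := k i - m, j := k j + m + 1)) x))"
    using c0 by (simp only: weight) (simp add: ennreal_mult[symmetric] gamma_tail_nonneg mult_ac)
  finally show ?thesis unfolding i_def j_def .
qed

text \<open>
  Both sides obey the same recursion when an arc out of a vertex without incoming arcs is eliminated.
  The positivity assumption gives that vertex a supply of at least \<open>1\<close>, as \<open>gamma_tail_add\<close> requires,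
  and it survives the elimination because the final vertex receives \<open>m + 1 > 0\<close>.
\<close>

theorem nn_integral_network_weight:
  assumes "finite A" "finite V"
    and "\<And>a. a \<in> A \<Longrightarrow> src a \<in> V \<and> tgt a \<in> V \<and> src a < tgt a"
    and "\<And>u. u \<in> V \<Longrightarrow> 0 < k u + card {a \<in> A. tgt a = u}"
  shows "finite (network_flows src tgt V A k) \<and>
    (\<integral>\<^sup>+x. ennreal (network_weight src tgt V A k x) * indicator {x. \<forall>a\<in>A. 0 \<le> x a} x
        \<partial>(\<Pi>\<^sub>M a\<in>A. lborel))
      = ennreal (card (network_flows src tgt V A k))"
  using assms
proof (induction "card A" arbitrary: A k)
  case 0
  then have "A = {}" by simp
  have "network_flows src tgt V {} k = {\<lambda>_. undefined}"
    using 0 \<open>A = {}\<close> by (auto simp: network_flows_def)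
  then show ?case
    unfolding \<open>A = {}\<close>
    by (subst product_sigma_finite.nn_integral_empty)
       (auto simp: network_weight_def gamma_tail_def PiM_empty product_sigma_finite_def
          intro: lborel.sigma_finite_measure_axioms)
next
  case (Suc c B)
  interpret P: product_sigma_finite "\<lambda>_. lborel :: real measure" ..
  have "B \<noteq> {}" using Suc.hyps by auto
  \<comment> \<open>Arcs go from smaller to larger vertices, so nothing enters a minimal initial vertex.\<close>
  then obtain a where a: "a \<in> B" "\<And>b. b \<in> B \<Longrightarrow> src a \<le> src b"
    using Suc.prems(1) ex_min_if_finite[of "src ` B"] by (metis (no_types, lifting) arg_min_if_finite(2) arg_min_if_finite(1) not_le)
  define A where "A = B - {a}"
  have B: "B = insert a A" and aA: "a \<notin> A" and fin: "finite A"
    using a Suc.prems by (auto simp: A_def)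
  have card: "c = card A" using Suc.hyps Suc.prems a by (simp add: A_def)
  have V: "src a \<in> V" "tgt a \<in> V" "src a \<noteq> tgt a" using Suc.prems(3)[OF a(1)] by auto
  have source: "tgt b \<noteq> src a" if "b \<in> A" for b
    using a(2)[of b] Suc.prems(3)[of b] that by (auto simp: A_def)
  define k' where "k' = (\<lambda>m. k(src a := k (src a) - m, tgt a := k (tgt a) + m + 1))"
  have no_in: "{b \<in> B. tgt b = src a} = {}" using source V(3) by (auto simp: B)
  have k1: "1 \<le> k (src a)" using Suc.prems(4)[OF V(1)] unfolding no_in by simp
  have pos: "0 < k' m u + card {b \<in> A. tgt b = u}" if "u \<in> V" "m < k (src a)" for u m
  proof (cases "u = tgt a \<or> u = src a")
    case False
    then have "{b \<in> A. tgt b = u} = {b \<in> B. tgt b = u}" by (auto simp: B)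
    then show ?thesis using Suc.prems(4)[OF that(1)] False by (simp add: k'_def)
  qed (use that in \<open>auto simp: k'_def\<close>)
  have IH: "finite (network_flows src tgt V A (k' m))"
    "(\<integral>\<^sup>+x. ennreal (network_weight src tgt V A (k' m) x) * indicator {x. \<forall>a\<in>A. 0 \<le> x a} x
        \<partial>(\<Pi>\<^sub>M a\<in>A. lborel))
      = ennreal (card (network_flows src tgt V A (k' m)))" if "m < k (src a)" for m
    using Suc.hyps(1)[OF card fin Suc.prems(2), of "k' m"] Suc.prems(3) pos that by (auto simp: B)
  have meas: "(\<lambda>x. ennreal (network_weight src tgt V A l x) * indicator {x. \<forall>a\<in>A. 0 \<le> x a} x)
      \<in> borel_measurable (\<Pi>\<^sub>M a\<in>A. lborel)" if "finite A" for A l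
  proof -
    have [measurable]: "Measurable.pred (\<Pi>\<^sub>M a\<in>A. (lborel::real measure)) (\<lambda>x. \<forall>a\<in>A. 0 \<le> x a)"
      using that by measurable
    have "(\<lambda>x. ennreal (network_weight src tgt V A l x) * (if \<forall>a\<in>A. 0 \<le> x a then 1 else 0))
      \<in> borel_measurable (\<Pi>\<^sub>M a\<in>A. lborel)"
      by measurable
    also have "?this \<longleftrightarrow> ?thesis" by (intro measurable_cong) (auto simp: indicator_def)
    finally show ?thesis .
  qed
  have flows: "finite (network_flows src tgt V B k)"
    "card (network_flows src tgt V B k) = (\<Sum>m<k (src a). card (network_flows src tgt V A (k' m)))"
    unfolding B k'_def
    by (rule card_network_flows_insert[where src = src and tgt = tgt, OF fin aA V];
        use source IH(1) in \<open>simp add: k'_def\<close>)+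
  have "(\<integral>\<^sup>+x. ennreal (network_weight src tgt V B k x) * indicator {x. \<forall>b\<in>B. 0 \<le> x b} x
        \<partial>(\<Pi>\<^sub>M a\<in>B. lborel))
    = (\<integral>\<^sup>+x. (\<integral>\<^sup>+y. ennreal (network_weight src tgt V B k (x(a := y)))
          * indicator {x. \<forall>b\<in>B. 0 \<le> x b} (x(a := y)) \<partial>lborel) \<partial>(\<Pi>\<^sub>M a\<in>A. lborel))"
    unfolding B by (rule P.product_nn_integral_insert[OF fin aA meas]) (use fin in simp)
  also have "\<dots> = (\<integral>\<^sup>+x. (\<Sum>m<k (src a). ennreal (network_weight src tgt V A (k' m) x)
          * indicator {x. \<forall>a\<in>A. 0 \<le> x a} x) \<partial>(\<Pi>\<^sub>M a\<in>A. lborel))"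
  proof (rule nn_integral_cong)
    fix x :: "'a \<Rightarrow> real"
    show "(\<integral>\<^sup>+y. ennreal (network_weight src tgt V B k (x(a := y)))
          * indicator {x. \<forall>b\<in>B. 0 \<le> x b} (x(a := y)) \<partial>lborel)
        = (\<Sum>m<k (src a). ennreal (network_weight src tgt V A (k' m) x)
          * indicator {x. \<forall>a\<in>A. 0 \<le> x a} x)"
    proof (cases "\<forall>b\<in>A. 0 \<le> x b")
      case True
      have "indicator {x. \<forall>b\<in>B. 0 \<le> x b} (x(a := y)) = (indicator {0..} y :: ennreal)" for y
        using True aA by (auto simp: B indicator_def)
      then have "(\<integral>\<^sup>+y. ennreal (network_weight src tgt V B k (x(a := y)))
          * indicator {x. \<forall>b\<in>B. 0 \<le> x b} (x(a := y)) \<partial>lborel)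
        = (\<integral>\<^sup>+y. ennreal (network_weight src tgt V (insert a A) k (x(a := y))) * indicator {0..} y \<partial>lborel)"
        by (simp add: B)
      also have "\<dots> = (\<Sum>m<k (src a). ennreal (network_weight src tgt V A (k' m) x))"
        unfolding k'_def
        using True by (intro nn_integral_network_weight_arc fin aA Suc.prems(2) V source k1) auto
      finally show ?thesis using True by simp
    next
      case False
      then have "indicator {x. \<forall>b\<in>B. 0 \<le> x b} (x(a := y)) = (0 :: ennreal)" for y
        using aA by (auto simp: B indicator_def)
      with False show ?thesis by simp
    qed
  qed
  also have "\<dots> = (\<Sum>m<k (src a). ennreal (card (network_flows src tgt V A (k' m))))"
    using IH(2) by (subst nn_integral_sum[OF meas[OF fin]]) simp
  also have "\<dots> = ennreal (card (network_flows src tgt V B k))"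
    by (simp add: flows(2))
  finally show ?case using flows(1) by blast
qed

section \<open>Lebesgue measure on coordinate spaces and the integer lattice\<close>

abbreviation lebesgue_on_coords :: "'a set \<Rightarrow> ('a \<Rightarrow> real) measure" where
  "lebesgue_on_coords J \<equiv> \<Pi>\<^sub>M i\<in>J. lborel"

lemma sigma_finite_lebesgue_on_coords:
  "finite J \<Longrightarrow> sigma_finite_measure (lebesgue_on_coords J)"
  by (intro product_sigma_finite.sigma_finite)
     (auto simp: product_sigma_finite_def intro: lborel.sigma_finite_measure_axioms)

lemma nn_integral_coords_affine:
  fixes J :: "'a set" and f :: "('a \<Rightarrow> real) \<Rightarrow> ennreal"
  assumes "finite J" "f \<in> borel_measurable (lebesgue_on_coords J)" "r \<noteq> 0"
  shows "(\<integral>\<^sup>+x. f x \<partial>lebesgue_on_coords J)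
    = ennreal (\<bar>r\<bar> ^ card J) * (\<integral>\<^sup>+x. f (\<lambda>i\<in>J. t i + r * x i) \<partial>lebesgue_on_coords J)"
  using assms(1,2)
proof (induction J arbitrary: f rule: finite_induct)
  case empty
  show ?case
    unfolding card.empty power_0 ennreal_1 mult_1_left
    by (intro nn_integral_cong arg_cong[where f = f]) (auto simp: space_PiM restrict_def)
next
  case (insert i J)
  interpret P: product_sigma_finite "\<lambda>_. lborel :: real measure" ..
  have upd: "(\<lambda>p. (fst p)(i := h (snd p))) \<in> measurable (lebesgue_on_coords J \<Otimes>\<^sub>M lborel) (lebesgue_on_coords (insert i J))"
    if "h \<in> borel_measurable borel" for h :: "real \<Rightarrow> real"
  proof (rule measurable_fun_upd[where J = J])
    show "(\<lambda>p. h (snd p)) \<in> measurable (lebesgue_on_coords J \<Otimes>\<^sub>M lborel) lborel"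
      using measurable_compose[OF measurable_snd, of h lborel borel] that by simp
  qed (auto intro: measurable_fst)
  define g where "g x = (\<integral>\<^sup>+y. f (x(i := t i + r * y)) \<partial>lborel)" for x
  have [measurable]: "g \<in> borel_measurable (lebesgue_on_coords J)"
    unfolding g_def
    by (rule lborel.borel_measurable_nn_integral, unfold split_beta')
       (rule measurable_compose[OF upd insert.prems], simp)
  have aff: "(\<lambda>x. \<lambda>j\<in>insert i J. t j + r * x j) \<in> measurable (lebesgue_on_coords (insert i J)) (lebesgue_on_coords (insert i J))"
    by (rule measurable_restrict) simp
  have "(\<integral>\<^sup>+x. f x \<partial>lebesgue_on_coords (insert i J))
      = (\<integral>\<^sup>+x. (\<integral>\<^sup>+y. f (x(i := y)) \<partial>lborel) \<partial>lebesgue_on_coords J)"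
    using insert by (intro P.product_nn_integral_insert) auto
  also have "\<dots> = (\<integral>\<^sup>+x. ennreal \<bar>r\<bar> * g x \<partial>lebesgue_on_coords J)"
  proof (rule nn_integral_cong)
    fix x assume x: "x \<in> space (lebesgue_on_coords J)"
    have "(\<lambda>y. f (x(i := y))) \<in> borel_measurable lborel"
      using measurable_compose[OF measurable_Pair1'[OF x] measurable_compose[OF upd[OF measurable_ident_sets[OF refl]] insert.prems]]
      by (simp only: fst_conv snd_conv)
    then have "(\<lambda>y. f (x(i := y))) \<in> borel_measurable borel"
      by (simp only: measurable_lborel2)
    then show "(\<integral>\<^sup>+y. f (x(i := y)) \<partial>lborel) = ennreal \<bar>r\<bar> * g x"
      unfolding g_def using \<open>r \<noteq> 0\<close> by (rule nn_integral_real_affine)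
  qed
  also have "\<dots> = ennreal \<bar>r\<bar> * (\<integral>\<^sup>+x. g x \<partial>lebesgue_on_coords J)"
    by (rule nn_integral_cmult) simp
  also have "(\<integral>\<^sup>+x. g x \<partial>lebesgue_on_coords J)
      = ennreal (\<bar>r\<bar> ^ card J) * (\<integral>\<^sup>+x. g (\<lambda>i\<in>J. t i + r * x i) \<partial>lebesgue_on_coords J)"
    by (rule insert.IH) simp
  also have "(\<integral>\<^sup>+x. g (\<lambda>i\<in>J. t i + r * x i) \<partial>lebesgue_on_coords J)
      = (\<integral>\<^sup>+x. (\<integral>\<^sup>+y. f (\<lambda>j\<in>insert i J. t j + r * (x(i := y)) j) \<partial>lborel) \<partial>lebesgue_on_coords J)"
    unfolding g_def using insert.hyps(2)
    by (intro nn_integral_cong arg_cong[where f = f] ext) simp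
  also have "\<dots> = (\<integral>\<^sup>+x. f (\<lambda>j\<in>insert i J. t j + r * x j) \<partial>lebesgue_on_coords (insert i J))"
    by (rule P.product_nn_integral_insert[symmetric, OF insert.hyps
          measurable_compose[OF aff insert.prems]])
  finally show ?case
    unfolding card_insert_disjoint[OF insert.hyps] power_Suc
      ennreal_mult[OF abs_ge_zero zero_le_power[OF abs_ge_zero]] mult.assoc .
qed

definition shift :: "'a set \<Rightarrow> ('a \<Rightarrow> real) \<Rightarrow> ('a \<Rightarrow> real) \<Rightarrow> 'a \<Rightarrow> real" where
  "shift J x y = (\<lambda>i\<in>J. x i + y i)"

lemma measurable_shift [measurable (raw)]:
  assumes "f \<in> measurable N (lebesgue_on_coords J)" "g \<in> measurable N (lebesgue_on_coords J)"
  shows "(\<lambda>w. shift J (f w) (g w)) \<in> measurable N (lebesgue_on_coords J)"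
  unfolding shift_def
proof (rule measurable_restrict)
  fix i assume i: "i \<in> J"
  have "(\<lambda>w. f w i) \<in> borel_measurable N" "(\<lambda>w. g w i) \<in> borel_measurable N"
    using measurable_compose[OF assms(1) measurable_component_singleton[OF i]]
      measurable_compose[OF assms(2) measurable_component_singleton[OF i]] by simp_all
  then show "(\<lambda>w. f w i + g w i) \<in> measurable N lborel" by simp
qed

lemma nn_integral_shift:
  assumes "finite J" "f \<in> borel_measurable (lebesgue_on_coords J)"
  shows "(\<integral>\<^sup>+x. f (shift J x y) \<partial>lebesgue_on_coords J) = (\<integral>\<^sup>+x. f x \<partial>lebesgue_on_coords J)"
  using nn_integral_coords_affine[OF assms, of 1 y] by (simp add: shift_def add.commute)

definition integer_vectors :: "'a set \<Rightarrow> ('a \<Rightarrow> real) set" where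
  "integer_vectors J = (J \<rightarrow>\<^sub>E \<int>)"

definition half_open_cube :: "'a set \<Rightarrow> ('a \<Rightarrow> real) set" where
  "half_open_cube J = (J \<rightarrow>\<^sub>E {0..<1})"

lemma countable_integer_vectors: "finite J \<Longrightarrow> countable (integer_vectors J)"
  unfolding integer_vectors_def by (intro countable_PiE) (auto simp: Ints_def)

lemma sets_half_open_cube [measurable]:
  "finite J \<Longrightarrow> half_open_cube J \<in> sets (lebesgue_on_coords J)"
  unfolding half_open_cube_def by (rule sets_PiM_I_finite) auto

lemma emeasure_half_open_cube: "finite J \<Longrightarrow> emeasure (lebesgue_on_coords J) (half_open_cube J) = 1"
  unfolding half_open_cube_def
  by (subst product_sigma_finite.emeasure_PiM)
     (auto simp: product_sigma_finite_def intro: lborel.sigma_finite_measure_axioms)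

lemma half_open_cube_tiles:
  fixes x :: "'a \<Rightarrow> real"
  shows "\<exists>!z. z \<in> integer_vectors J \<and> shift J x (\<lambda>i. - z i) \<in> half_open_cube J"
proof (rule ex1I)
  let ?z = "\<lambda>i\<in>J. of_int \<lfloor>x i\<rfloor> :: real"
  show "?z \<in> integer_vectors J \<and> shift J x (\<lambda>i. - ?z i) \<in> half_open_cube J"
    by (auto simp: integer_vectors_def half_open_cube_def shift_def) linarith+
  fix z assume z: "z \<in> integer_vectors J \<and> shift J x (\<lambda>i. - z i) \<in> half_open_cube J"
  show "z = ?z"
  proof
    fix i
    show "z i = ?z i"
    proof (cases "i \<in> J")
      case True
      with z obtain k where k: "z i = of_int k"
        by (auto simp: integer_vectors_def Ints_def PiE_def Pi_def)
      have "0 \<le> x i - z i" "x i - z i < 1"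
        using z True by (auto simp: half_open_cube_def shift_def PiE_def Pi_def)
      then have "\<lfloor>x i\<rfloor> = k" unfolding k by linarith
      with True k show ?thesis by simp
    qed (use z in \<open>auto simp: integer_vectors_def PiE_def extensional_def\<close>)
  qed
qed

text \<open>
  A sum over \<open>Z\<close> in which exactly one term is \<open>1\<close>; this expresses tilings as integrals over the counting
  measure, which can be interchanged with Lebesgue integrals.
\<close>

lemma nn_integral_count_space_unique:
  assumes "\<exists>!z. z \<in> Z \<and> z \<in> T"
  shows "(\<integral>\<^sup>+z. indicator T z \<partial>count_space Z) = (1 :: ennreal)"
proof -
  obtain w where w: "w \<in> Z" "w \<in> T" "\<And>z. z \<in> Z \<Longrightarrow> z \<in> T \<Longrightarrow> z = w"
    using assms by auto
  have "(\<integral>\<^sup>+z. indicator T z \<partial>count_space Z) = (\<integral>\<^sup>+z. indicator {w} z \<partial>count_space Z)"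
  proof (rule nn_integral_cong)
    fix z assume "z \<in> space (count_space Z)"
    then have "z \<in> T \<longleftrightarrow> z = w" using w(1,2) w(3)[of z] by auto
    then show "indicator T z = (indicator {w} z :: ennreal)" by (simp add: indicator_def)
  qed
  also have "\<dots> = 1" using w(1) by (simp add: nn_integral_indicator)
  finally show ?thesis .
qed

text \<open>
  Cut \<open>B\<close> along the integer translates of the unit cube and move the pieces back into the cube. Since
  the translates of \<open>B\<close> tile the space as well, the moved pieces partition the cube.
\<close>

lemma emeasure_integer_tile:
  assumes J: "finite J" and B: "B \<in> sets (lebesgue_on_coords J)"
    and tiles: "\<And>x. x \<in> J \<rightarrow>\<^sub>E UNIV \<Longrightarrow> \<exists>!z. z \<in> integer_vectors J \<and> shift J x z \<in> B"
  shows "emeasure (lebesgue_on_coords J) B = 1"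
proof -
  let ?M = "lebesgue_on_coords J" and ?Z = "integer_vectors J" and ?T = "half_open_cube J"
  note [measurable] = B sets_half_open_cube[OF J]
  have [measurable]: "(\<lambda>x. shift J x z) \<in> measurable ?M ?M" for z
  proof -
    have "(\<lambda>x. \<lambda>i\<in>J. x i + z i) \<in> measurable ?M ?M" by measurable
    then show ?thesis unfolding shift_def .
  qed
  have "emeasure ?M B = (\<integral>\<^sup>+x. indicator B x * 1 \<partial>?M)" by simp
  also have "\<dots> = (\<integral>\<^sup>+x. indicator B x *
      (\<integral>\<^sup>+z. indicator ?T (shift J x (\<lambda>i. - z i)) \<partial>count_space ?Z) \<partial>?M)"
  proof (rule nn_integral_cong)
    fix x
    show "indicator B x * 1 = (indicator B x *
      (\<integral>\<^sup>+z. indicator ?T (shift J x (\<lambda>i. - z i)) \<partial>count_space ?Z) :: ennreal)"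
      using nn_integral_count_space_unique[of ?Z "{z. shift J x (\<lambda>i. - z i) \<in> ?T}"] half_open_cube_tiles[of J x]
      by (simp add: indicator_def)
  qed
  also have "\<dots> = (\<integral>\<^sup>+x. (\<integral>\<^sup>+z. indicator B x * indicator ?T (shift J x (\<lambda>i. - z i)) \<partial>count_space ?Z) \<partial>?M)"
    by (simp add: nn_integral_cmult)
  also have "\<dots> = (\<integral>\<^sup>+z. (\<integral>\<^sup>+x. indicator B x * indicator ?T (shift J x (\<lambda>i. - z i)) \<partial>?M) \<partial>count_space ?Z)"
    using countable_integer_vectors[OF J] by (intro nn_integral_count_space_nn_integral) measurable
  also have "\<dots> = (\<integral>\<^sup>+z. (\<integral>\<^sup>+x. indicator B (shift J x z) * indicator ?T x \<partial>?M) \<partial>count_space ?Z)"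
  proof (rule nn_integral_cong)
    fix z
    have "(\<integral>\<^sup>+x. indicator B x * indicator ?T (shift J x (\<lambda>i. - z i)) \<partial>?M)
        = (\<integral>\<^sup>+x. indicator B (shift J x z) * indicator ?T (shift J (shift J x z) (\<lambda>i. - z i)) \<partial>?M)"
      by (rule nn_integral_shift[OF J, symmetric]) measurable
    also have "\<dots> = (\<integral>\<^sup>+x. indicator B (shift J x z) * indicator ?T x \<partial>?M)"
    proof (rule nn_integral_cong)
      fix x assume "x \<in> space ?M"
      then have "shift J (shift J x z) (\<lambda>i. - z i) = x"
        by (auto simp: shift_def space_PiM PiE_def extensional_def fun_eq_iff)
      then show "indicator B (shift J x z) * indicator ?T (shift J (shift J x z) (\<lambda>i. - z i))
          = (indicator B (shift J x z) * indicator ?T x :: ennreal)" by simp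
    qed
    finally show "(\<integral>\<^sup>+x. indicator B x * indicator ?T (shift J x (\<lambda>i. - z i)) \<partial>?M)
        = (\<integral>\<^sup>+x. indicator B (shift J x z) * indicator ?T x \<partial>?M)" .
  qed
  also have "\<dots> = (\<integral>\<^sup>+x. (\<integral>\<^sup>+z. indicator B (shift J x z) * indicator ?T x \<partial>count_space ?Z) \<partial>?M)"
    using countable_integer_vectors[OF J] by (intro nn_integral_count_space_nn_integral[symmetric]) measurable
  also have "\<dots> = (\<integral>\<^sup>+x. (\<integral>\<^sup>+z. indicator B (shift J x z) \<partial>count_space ?Z) * indicator ?T x \<partial>?M)"
    by (simp add: nn_integral_multc)
  also have "\<dots> = (\<integral>\<^sup>+x. indicator ?T x \<partial>?M)"
  proof (rule nn_integral_cong)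
    fix x assume "x \<in> space ?M"
    then have "(\<integral>\<^sup>+z. indicator B (shift J x z) \<partial>count_space ?Z) = (1 :: ennreal)"
      using nn_integral_count_space_unique[of ?Z "{z. shift J x z \<in> B}"] tiles[of x]
      by (simp add: indicator_def space_PiM)
    then show "(\<integral>\<^sup>+z. indicator B (shift J x z) \<partial>count_space ?Z) * indicator ?T x
        = (indicator ?T x :: ennreal)" by simp
  qed
  also have "\<dots> = 1" by (simp add: emeasure_half_open_cube[OF J])
  finally show ?thesis .
qed

definition matrix_map :: "'a set \<Rightarrow> ('a \<Rightarrow> 'a \<Rightarrow> int) \<Rightarrow> ('a \<Rightarrow> real) \<Rightarrow> 'a \<Rightarrow> real" where
  "matrix_map J A x = (\<lambda>i\<in>J. \<Sum>j\<in>J. of_int (A i j) * x j)"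

lemma measurable_matrix_map [measurable]:
  "matrix_map J A \<in> measurable (lebesgue_on_coords J) (lebesgue_on_coords J)"
  unfolding matrix_map_def[abs_def]
proof (rule measurable_restrict)
  fix i
  have component: "(\<lambda>x. x j) \<in> borel_measurable (lebesgue_on_coords J)" if "j \<in> J" for j
    using measurable_component_singleton[OF that, of "\<lambda>_. lborel"] by (simp only: measurable_lborel1)
  have "(\<lambda>x. \<Sum>j\<in>J. of_int (A i j) * x j) \<in> borel_measurable (lebesgue_on_coords J)"
    by (intro borel_measurable_sum borel_measurable_times borel_measurable_const component)
  then show "(\<lambda>x. \<Sum>j\<in>J. of_int (A i j) * x j) \<in> measurable (lebesgue_on_coords J) lborel"
    by (simp only: measurable_lborel1)
qed

lemma matrix_map_shift:
  "matrix_map J A (shift J x y) = shift J (matrix_map J A x) (matrix_map J A y)"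
proof -
  have coordinate: "shift J f g i = (if i \<in> J then f i + g i else undefined)" for f g i
    by (simp add: shift_def)
  have entry: "matrix_map J A f i = (if i \<in> J then \<Sum>j\<in>J. of_int (A i j) * f j else undefined)" for f i
    by (simp add: matrix_map_def)
  have "(\<Sum>j\<in>J. of_int (A i j) * shift J x y j)
      = (\<Sum>j\<in>J. of_int (A i j) * x j) + (\<Sum>j\<in>J. of_int (A i j) * y j)" for i
    unfolding sum.distrib[symmetric] by (intro sum.cong refl) (simp add: shift_def distrib_left)
  then have "matrix_map J A (shift J x y) i = shift J (matrix_map J A x) (matrix_map J A y) i" for i
    by (cases "i \<in> J"; simp only: coordinate[of "matrix_map J A x"] entry if_True if_False)
  then show ?thesis by blast
qed

lemma matrix_map_integer:
  assumes "z \<in> integer_vectors J"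
  shows "matrix_map J A z \<in> integer_vectors J"
proof -
  have z: "z j \<in> \<int>" if "j \<in> J" for j
    using assms that by (auto simp: integer_vectors_def)
  have "(\<Sum>j\<in>J. of_int (A i j) * z j) \<in> \<int>" for i
    by (intro Ints_sum Ints_mult Ints_of_int z)
  then show ?thesis
    unfolding matrix_map_def integer_vectors_def restrict_PiE_iff by blast
qed

lemma matrix_map_inverse:
  assumes "finite J" and x: "x \<in> J \<rightarrow>\<^sub>E UNIV"
    and inv: "\<And>i k. i \<in> J \<Longrightarrow> k \<in> J \<Longrightarrow> (\<Sum>j\<in>J. A i j * A' j k) = (if i = k then 1 else 0)"
  shows "matrix_map J A (matrix_map J A' x) = x"
proof
  fix i
  show "matrix_map J A (matrix_map J A' x) i = x i"
  proof (cases "i \<in> J")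
    case True
    have "matrix_map J A (matrix_map J A' x) i
        = (\<Sum>j\<in>J. \<Sum>k\<in>J. of_int (A i j) * (of_int (A' j k) * x k))"
      using True by (auto simp: matrix_map_def sum_distrib_left intro!: sum.cong)
    also have "\<dots> = (\<Sum>k\<in>J. \<Sum>j\<in>J. of_int (A i j) * (of_int (A' j k) * x k))"
      by (rule sum.swap)
    also have "\<dots> = (\<Sum>k\<in>J. of_int (\<Sum>j\<in>J. A i j * A' j k) * x k)"
      by (simp add: sum_distrib_right mult.assoc)
    also have "\<dots> = (\<Sum>k\<in>J. if i = k then x k else 0)"
      by (intro sum.cong refl) (simp only: inv[OF True], simp)
    also have "\<dots> = x i" using True assms(1) by simp
    finally show ?thesis .
  qed (use x in \<open>auto simp: matrix_map_def PiE_def extensional_def\<close>)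
qed

lemma emeasure_preimage_eq_nn_integral:
  assumes "f \<in> measurable M N" "S \<in> sets N"
  shows "emeasure M {x \<in> space M. f x \<in> S} = (\<integral>\<^sup>+x. indicator S (f x) \<partial>M)"
proof -
  have "{x \<in> space M. f x \<in> S} = f -` S \<inter> space M" by auto
  then have "{x \<in> space M. f x \<in> S} \<in> sets M"
    using measurable_sets[OF assms] by simp
  then have "emeasure M {x \<in> space M. f x \<in> S} = (\<integral>\<^sup>+x. indicator {x \<in> space M. f x \<in> S} x \<partial>M)"
    by (rule nn_integral_indicator[symmetric])
  also have "\<dots> = (\<integral>\<^sup>+x. indicator S (f x) \<partial>M)"
    by (intro nn_integral_cong) (simp add: indicator_def)
  finally show ?thesis .
qed

text \<open>
  The affine map \<open>f\<close> with matrix \<open>A\<close> pulls the measure back to a translation invariant one. As in the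
  uniqueness proof for Haar measure, the preimage of \<open>S\<close> is compared with \<open>S\<close> by integrating
  \<open>indicator T y * indicator S (f x + y)\<close> over \<open>x\<close> and \<open>y\<close>, where \<open>T\<close> is the unit cube. Integrating
  first over \<open>x\<close> gives the measure of the preimage; integrating first over \<open>y\<close> and replacing \<open>f x + y\<close>
  by \<open>y\<close> gives the integral over \<open>S\<close> of the measure of all \<open>x\<close> with \<open>y - f x\<close> in \<open>T\<close>. This last set is a
  tile for the integer translations, since \<open>A\<close> permutes the integer vectors.
\<close>

theorem emeasure_unimodular_preimage:
  assumes J: "finite J"
    and inv: "\<And>i k. i \<in> J \<Longrightarrow> k \<in> J \<Longrightarrow> (\<Sum>j\<in>J. A i j * A' j k) = (if i = k then 1 else 0)"
    and inv': "\<And>i k. i \<in> J \<Longrightarrow> k \<in> J \<Longrightarrow> (\<Sum>j\<in>J. A' i j * A j k) = (if i = k then 1 else 0)"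
    and S: "S \<in> sets (lebesgue_on_coords J)"
  shows "emeasure (lebesgue_on_coords J) {x \<in> J \<rightarrow>\<^sub>E UNIV. shift J (matrix_map J A x) c \<in> S}
    = emeasure (lebesgue_on_coords J) S"
proof -
  let ?M = "lebesgue_on_coords J" and ?Z = "integer_vectors J" and ?T = "half_open_cube J"
  let ?f = "\<lambda>x. shift J (matrix_map J A x) c"
  let ?neg = "\<lambda>x. \<lambda>i\<in>J. - x i :: real"
  interpret sigma_finite_measure ?M by (rule sigma_finite_lebesgue_on_coords[OF J])
  interpret P: pair_sigma_finite ?M ?M ..
  note [measurable] = S sets_half_open_cube[OF J]
  have [measurable]: "?f \<in> measurable ?M ?M"
  proof -
    have "(\<lambda>x. \<lambda>i\<in>J. matrix_map J A x i + c i) \<in> measurable ?M ?M"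
    proof (rule measurable_restrict)
      fix i assume "i \<in> J"
      then have "(\<lambda>x. matrix_map J A x i) \<in> borel_measurable ?M"
        using measurable_compose[OF measurable_matrix_map[of J A] measurable_component_singleton[of i J]]
        by (simp only: measurable_lborel1)
      then show "(\<lambda>x. matrix_map J A x i + c i) \<in> measurable ?M lborel"
        unfolding measurable_lborel1 by (intro borel_measurable_add borel_measurable_const)
    qed
    then show ?thesis unfolding shift_def .
  qed
  have [measurable]: "?neg \<in> measurable ?M ?M" by measurable
  have f_shift: "?f (shift J x (matrix_map J A' y)) = shift J (?f x) y" if "y \<in> space ?M" for x y
  proof -
    have "matrix_map J A (matrix_map J A' y) = y"
      using that by (intro matrix_map_inverse J inv) (auto simp: space_PiM)
    then show ?thesis unfolding matrix_map_shift by (auto simp: shift_def fun_eq_iff)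
  qed
  have tile: "emeasure ?M {x \<in> space ?M. shift J y (?neg (?f x)) \<in> ?T} = 1"
    if y: "y \<in> space ?M" for y
  proof (rule emeasure_integer_tile[OF J])
    have "(\<lambda>x. shift J y (?neg (?f x))) \<in> measurable ?M ?M"
      using y by (intro measurable_shift) measurable
    then show "{x \<in> space ?M. shift J y (?neg (?f x)) \<in> ?T} \<in> sets ?M"
      by measurable
    fix x :: "'a \<Rightarrow> real" assume x: "x \<in> J \<rightarrow>\<^sub>E UNIV"
    define u where "u = shift J y (?neg (?f x))"
    have eq: "shift J y (?neg (?f (shift J x z))) = shift J u (\<lambda>i. - matrix_map J A z i)" for z
      unfolding u_def matrix_map_shift by (auto simp: shift_def fun_eq_iff)
    obtain w where w: "w \<in> ?Z" "shift J u (\<lambda>i. - w i) \<in> ?T"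
      "\<And>w'. w' \<in> ?Z \<Longrightarrow> shift J u (\<lambda>i. - w' i) \<in> ?T \<Longrightarrow> w' = w"
      using half_open_cube_tiles[of J u] by auto
    have Z: "?Z \<subseteq> J \<rightarrow>\<^sub>E UNIV" by (auto simp: integer_vectors_def)
    have sp: "shift J x z \<in> space ?M" for z by (auto simp: shift_def space_PiM)
    show "\<exists>!z. z \<in> ?Z \<and> shift J x z \<in> {x \<in> space ?M. shift J y (?neg (?f x)) \<in> ?T}"
    proof (rule ex1I)
      show "matrix_map J A' w \<in> ?Z \<and>
          shift J x (matrix_map J A' w) \<in> {x \<in> space ?M. shift J y (?neg (?f x)) \<in> ?T}"
        using w(1,2) sp Z matrix_map_inverse[OF J _ inv, of w]
        by (auto simp: matrix_map_integer eq)
      fix z assume z: "z \<in> ?Z \<and> shift J x z \<in> {x \<in> space ?M. shift J y (?neg (?f x)) \<in> ?T}"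
      then have "matrix_map J A z = w"
        using w(3)[OF matrix_map_integer[of z J A]] by (auto simp: eq)
      then show "z = matrix_map J A' w"
        using matrix_map_inverse[OF J _ inv', of z] z Z by auto
    qed
  qed
  have f_pair [measurable]: "(\<lambda>p. ?f (fst p)) \<in> measurable (?M \<Otimes>\<^sub>M ?M) ?M"
    "(\<lambda>p. ?f (snd p)) \<in> measurable (?M \<Otimes>\<^sub>M ?M) ?M"
    using measurable_compose[OF measurable_fst \<open>?f \<in> measurable ?M ?M\<close>, of ?M]
      measurable_compose[OF measurable_snd \<open>?f \<in> measurable ?M ?M\<close>, of ?M] by auto
  have "{x \<in> J \<rightarrow>\<^sub>E UNIV. ?f x \<in> S} = {x \<in> space ?M. ?f x \<in> S}"
    by (simp add: space_PiM)
  then have "emeasure ?M {x \<in> J \<rightarrow>\<^sub>E UNIV. ?f x \<in> S} = (\<integral>\<^sup>+x. indicator S (?f x) \<partial>?M)"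
    using emeasure_preimage_eq_nn_integral[OF \<open>?f \<in> measurable ?M ?M\<close> S] by simp
  also have "\<dots> = (\<integral>\<^sup>+y. indicator ?T y * (\<integral>\<^sup>+x. indicator S (?f x) \<partial>?M) \<partial>?M)"
    by (simp add: nn_integral_multc emeasure_half_open_cube[OF J])
  also have "\<dots> = (\<integral>\<^sup>+y. (\<integral>\<^sup>+x. indicator ?T y * indicator S (shift J (?f x) y) \<partial>?M) \<partial>?M)"
  proof (rule nn_integral_cong)
    fix y assume y: "y \<in> space ?M"
    have "(\<integral>\<^sup>+x. indicator S (?f x) \<partial>?M) = (\<integral>\<^sup>+x. indicator S (?f (shift J x (matrix_map J A' y))) \<partial>?M)"
      by (rule nn_integral_shift[OF J, symmetric]) measurable
    also have "\<dots> = (\<integral>\<^sup>+x. indicator S (shift J (?f x) y) \<partial>?M)"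
      by (simp only: f_shift[OF y])
    finally show "indicator ?T y * (\<integral>\<^sup>+x. indicator S (?f x) \<partial>?M)
        = (\<integral>\<^sup>+x. indicator ?T y * indicator S (shift J (?f x) y) \<partial>?M)"
      using y by (subst nn_integral_cmult) auto
  qed
  also have "\<dots> = (\<integral>\<^sup>+x. (\<integral>\<^sup>+y. indicator ?T y * indicator S (shift J (?f x) y) \<partial>?M) \<partial>?M)"
    by (rule P.Fubini') (simp add: split_beta')
  also have "\<dots> = (\<integral>\<^sup>+x. (\<integral>\<^sup>+y. indicator ?T (shift J y (?neg (?f x))) * indicator S y \<partial>?M) \<partial>?M)"
  proof (rule nn_integral_cong)
    fix x assume x: "x \<in> space ?M"
    have "(\<integral>\<^sup>+y. indicator ?T (shift J y (?neg (?f x))) * indicator S y \<partial>?M)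
      = (\<integral>\<^sup>+y. indicator ?T (shift J (shift J y (?f x)) (?neg (?f x))) * indicator S (shift J y (?f x)) \<partial>?M)"
      by (rule nn_integral_shift[OF J, symmetric]) (use x in measurable)
    also have "\<dots> = (\<integral>\<^sup>+y. indicator ?T y * indicator S (shift J (?f x) y) \<partial>?M)"
    proof (rule nn_integral_cong)
      fix y assume "y \<in> space ?M"
      then have "shift J (shift J y (?f x)) (?neg (?f x)) = y" "shift J y (?f x) = shift J (?f x) y"
        by (auto simp: shift_def space_PiM PiE_def extensional_def fun_eq_iff)
      then show "indicator ?T (shift J (shift J y (?f x)) (?neg (?f x))) * indicator S (shift J y (?f x))
          = (indicator ?T y * indicator S (shift J (?f x) y) :: ennreal)" by simp
    qed
    finally show "(\<integral>\<^sup>+y. indicator ?T y * indicator S (shift J (?f x) y) \<partial>?M)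
        = (\<integral>\<^sup>+y. indicator ?T (shift J y (?neg (?f x))) * indicator S y \<partial>?M)" ..
  qed
  also have "\<dots> = (\<integral>\<^sup>+y. (\<integral>\<^sup>+x. indicator ?T (shift J y (?neg (?f x))) * indicator S y \<partial>?M) \<partial>?M)"
    by (rule P.Fubini'[symmetric]) (simp add: split_beta')
  also have "\<dots> = (\<integral>\<^sup>+y. indicator S y \<partial>?M)"
  proof (rule nn_integral_cong)
    fix y assume y: "y \<in> space ?M"
    have [measurable]: "(\<lambda>x. shift J y (?neg (?f x))) \<in> measurable ?M ?M"
      using y by (intro measurable_shift) measurable
    have "(\<integral>\<^sup>+x. indicator ?T (shift J y (?neg (?f x))) \<partial>?M)
        = emeasure ?M {x \<in> space ?M. shift J y (?neg (?f x)) \<in> ?T}"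
      by (rule emeasure_preimage_eq_nn_integral[symmetric]) measurable
    then show "(\<integral>\<^sup>+x. indicator ?T (shift J y (?neg (?f x))) * indicator S y \<partial>?M) = indicator S y"
      by (simp add: nn_integral_multc tile[OF y])
  qed
  also have "\<dots> = emeasure ?M S" by simp
  finally show ?thesis .
qed

section \<open>The normalized volume in one lattice frame\<close>

lemma independent_combination_unique:
  fixes v :: "nat \<Rightarrow> 'a::real_vector"
  assumes "inj_on v {..<d}" "independent (v ` {..<d})"
    and "(\<Sum>k<d. a k *\<^sub>R v k) = (\<Sum>k<d. b k *\<^sub>R v k)" "k < d"
  shows "a k = b k"
proof -
  let ?u = "\<lambda>w. a (inv_into {..<d} v w) - b (inv_into {..<d} v w)"
  have "(\<Sum>w\<in>v ` {..<d}. ?u w *\<^sub>R w) = (\<Sum>k<d. (a k - b k) *\<^sub>R v k)"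
    using assms(1) by (simp add: sum.reindex)
  also have "\<dots> = 0"
    using assms(3) by (simp add: scaleR_diff_left sum_subtractf)
  finally have "?u (v k) = 0"
    using independentD[OF assms(2), of "v ` {..<d}" ?u "v k"] assms(4) by blast
  then show ?thesis using assms(1,4) by simp
qed

text \<open>
  The origin and the tips of the vectors of one frame have integer coordinates in that frame, so they
  are integer points and have integer coordinates in the other frame too.
\<close>

lemma lattice_frame_change:
  assumes "lattice_frame P d p v" "lattice_frame P d' p' v'"
  obtains c :: "nat \<Rightarrow> int" and A :: "nat \<Rightarrow> nat \<Rightarrow> int"
  where "p' = affine_coords d p v (\<lambda>k. of_int (c k))"
    and "\<And>j. j < d' \<Longrightarrow> v' j = (\<Sum>k<d. of_int (A k j) *\<^sub>R v k)"
proof -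
  have eq: "range (\<lambda>c :: nat \<Rightarrow> int. affine_coords d' p' v' (\<lambda>k. of_int (c k)))
      = range (\<lambda>c :: nat \<Rightarrow> int. affine_coords d p v (\<lambda>k. of_int (c k)))"
    using assms unfolding lattice_frame_def by argo
  have ex: "\<exists>a :: nat \<Rightarrow> int. affine_coords d' p' v' (\<lambda>k. of_int (e k)) = affine_coords d p v (\<lambda>k. of_int (a k))"
    for e :: "nat \<Rightarrow> int"
    using eq by blast
  obtain c :: "nat \<Rightarrow> int" where c: "p' = affine_coords d p v (\<lambda>k. of_int (c k))"
    using ex[of "\<lambda>_. 0"] by (auto simp: affine_coords_def)
  have "\<exists>a :: nat \<Rightarrow> int. v' j = (\<Sum>k<d. of_int (a k) *\<^sub>R v k)" if "j < d'" for j
  proof -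
    obtain a :: "nat \<Rightarrow> int" where
      a: "affine_coords d' p' v' (\<lambda>k. of_int (if k = j then 1 else 0)) = affine_coords d p v (\<lambda>k. of_int (a k))"
      using ex[of "\<lambda>k. if k = j then 1 else 0"] by blast
    have "(\<Sum>k<d'. real_of_int (if k = j then 1 else 0) *\<^sub>R v' k) = (\<Sum>k<d'. if k = j then v' k else 0)"
      by (intro sum.cong) auto
    also have "\<dots> = v' j" using that by simp
    finally have "p' + v' j = affine_coords d p v (\<lambda>k. of_int (a k))"
      using a by (simp add: affine_coords_def)
    then have "v' j = (\<Sum>k<d. of_int (a k - c k) *\<^sub>R v k)"
      unfolding c affine_coords_def
      by (simp add: scaleR_diff_left sum_subtractf algebra_simps)
    then show ?thesis by (rule exI[of _ "\<lambda>k. a k - c k"])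
  qed
  then obtain a :: "nat \<Rightarrow> nat \<Rightarrow> int" where
    "\<And>j. j < d' \<Longrightarrow> v' j = (\<Sum>k<d. of_int (a j k) *\<^sub>R v k)" by metis
  with c that[of c "\<lambda>k j. a j k"] show thesis by blast
qed

lemma lattice_frame_dim_le:
  assumes "lattice_frame P d p v" "lattice_frame P d' p' v'"
  shows "d' \<le> d"
proof -
  obtain A :: "nat \<Rightarrow> nat \<Rightarrow> int" where A: "\<And>j. j < d' \<Longrightarrow> v' j = (\<Sum>k<d. of_int (A k j) *\<^sub>R v k)"
    using lattice_frame_change[OF assms] by metis
  have "v' j \<in> span (v ` {..<d})" if "j < d'" for j
    unfolding A[OF that] by (intro span_sum span_scale span_base) simp
  then have "v' ` {..<d'} \<subseteq> span (v ` {..<d})" by auto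
  then have "card (v' ` {..<d'}) \<le> card (v ` {..<d})"
    using independent_span_bound[of "v ` {..<d}" "v' ` {..<d'}"] assms(2)
    by (simp add: lattice_frame_def)
  with assms show ?thesis by (simp add: lattice_frame_def card_image)
qed

lemma combination_of_combinations:
  fixes v :: "nat \<Rightarrow> 'a::real_vector" and A :: "nat \<Rightarrow> nat \<Rightarrow> int"
  assumes "\<And>j. j < d \<Longrightarrow> w j = (\<Sum>k<d. of_int (A k j) *\<^sub>R v k)"
  shows "(\<Sum>j<d. x j *\<^sub>R w j) = (\<Sum>k<d. matrix_map {..<d} A x k *\<^sub>R v k)"
proof -
  have "(\<Sum>j<d. x j *\<^sub>R w j) = (\<Sum>j<d. \<Sum>k<d. (of_int (A k j) * x j) *\<^sub>R v k)"
    by (intro sum.cong refl) (simp add: assms scaleR_sum_right mult.commute)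
  also have "\<dots> = (\<Sum>k<d. \<Sum>j<d. (of_int (A k j) * x j) *\<^sub>R v k)"
    by (rule sum.swap)
  also have "\<dots> = (\<Sum>k<d. matrix_map {..<d} A x k *\<^sub>R v k)"
    by (intro sum.cong refl) (simp add: matrix_map_def scaleR_sum_left)
  finally show ?thesis .
qed

lemma change_matrices_inverse:
  fixes v w :: "nat \<Rightarrow> 'a::real_vector" and A A' :: "nat \<Rightarrow> nat \<Rightarrow> int"
  assumes v: "inj_on v {..<d}" "independent (v ` {..<d})"
    and A: "\<And>j. j < d \<Longrightarrow> w j = (\<Sum>k<d. of_int (A k j) *\<^sub>R v k)"
    and A': "\<And>j. j < d \<Longrightarrow> v j = (\<Sum>k<d. of_int (A' k j) *\<^sub>R w k)"
    and ik: "i < d" "k < d"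
  shows "(\<Sum>j<d. A i j * A' j k) = (if i = k then 1 else 0)"
proof -
  have "(\<Sum>i<d. (if i = k then 1 else 0) *\<^sub>R v i) = (\<Sum>i<d. if i = k then v i else 0)"
    by (intro sum.cong) auto
  also have "\<dots> = v k" using ik by simp
  also have "v k = (\<Sum>j<d. of_int (A' j k) *\<^sub>R w j)" using A' ik by simp
  also have "\<dots> = (\<Sum>i<d. matrix_map {..<d} A (\<lambda>j. of_int (A' j k)) i *\<^sub>R v i)"
    by (rule combination_of_combinations) (rule A)
  finally have "(if i = k then 1 else 0) = matrix_map {..<d} A (\<lambda>j. of_int (A' j k)) i"
    by (rule independent_combination_unique[where a = "\<lambda>i. if i = k then 1 else 0", OF v _ ik(1)])
  from this[symmetric] have "real_of_int (\<Sum>j<d. A i j * A' j k) = of_int (if i = k then 1 else 0)"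
    using ik by (simp add: matrix_map_def)
  then show ?thesis by (simp only: of_int_eq_iff)
qed

text \<open>
  By \<open>lattice_frame_change\<close> in both directions, the change of coordinates between two frames is an
  affine map with an integer matrix and an integer inverse, and it preserves the measure.
\<close>

theorem normalized_volume_eqI:
  assumes frame: "lattice_frame P d p v"
    and S: "{x \<in> {..<d} \<rightarrow>\<^sub>E UNIV. affine_coords d p v x \<in> P} \<in> sets (lebesgue_on_coords {..<d})"
    and r: "r = fact d * measure (lebesgue_on_coords {..<d})
              {x \<in> {..<d} \<rightarrow>\<^sub>E UNIV. affine_coords d p v x \<in> P}"
  shows "normalized_volume P = r"
  unfolding normalized_volume_def
proof (rule the_equality)
  show "\<exists>d p v. lattice_frame P d p v \<and> r = fact d * measure (lebesgue_on_coords {..<d})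
              {x \<in> {..<d} \<rightarrow>\<^sub>E UNIV. affine_coords d p v x \<in> P}"
    using frame r by blast
  fix s
  assume "\<exists>d p v. lattice_frame P d p v \<and> s = fact d * measure (lebesgue_on_coords {..<d})
              {x \<in> {..<d} \<rightarrow>\<^sub>E UNIV. affine_coords d p v x \<in> P}"
  then obtain d' p' v' where frame'': "lattice_frame P d' p' v'"
    and s: "s = fact d' * measure (lebesgue_on_coords {..<d'})
              {x \<in> {..<d'} \<rightarrow>\<^sub>E UNIV. affine_coords d' p' v' x \<in> P}" by blast
  have d': "d' = d"
    using lattice_frame_dim_le frame frame'' by (blast intro: antisym)
  note frame' = frame''[unfolded d']
  obtain c A where c: "p' = affine_coords d p v (\<lambda>k. of_int (c k))"
    and A: "\<And>j. j < d \<Longrightarrow> v' j = (\<Sum>k<d. of_int (A k j) *\<^sub>R v k)"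
    using lattice_frame_change[OF frame frame'] by blast
  obtain A' where A': "\<And>j. j < d \<Longrightarrow> v j = (\<Sum>k<d. of_int (A' k j) *\<^sub>R v' k)"
    using lattice_frame_change[OF frame' frame] by blast
  have inv: "(\<Sum>j\<in>{..<d}. A i j * A' j k) = (if i = k then 1 else 0)" if "i \<in> {..<d}" "k \<in> {..<d}" for i k
  proof (rule change_matrices_inverse[where v = v and w = v'])
    show "inj_on v {..<d}" "independent (v ` {..<d})"
      using frame by (simp_all add: lattice_frame_def)
  qed (erule A, erule A', use that in auto)
  have inv': "(\<Sum>j\<in>{..<d}. A' i j * A j k) = (if i = k then 1 else 0)" if "i \<in> {..<d}" "k \<in> {..<d}" for i k
  proof (rule change_matrices_inverse[where v = v' and w = v])
    show "inj_on v' {..<d}" "independent (v' ` {..<d})"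
      using frame' by (simp_all add: lattice_frame_def)
  qed (erule A', erule A, use that in auto)
  let ?S = "{x \<in> {..<d} \<rightarrow>\<^sub>E UNIV. affine_coords d p v x \<in> P}"
  have coords: "affine_coords d p' v' x
      = affine_coords d p v (shift {..<d} (matrix_map {..<d} A x) (\<lambda>k. of_int (c k)))"
    for x
  proof -
    have "(\<Sum>j<d. x j *\<^sub>R v' j) = (\<Sum>k<d. matrix_map {..<d} A x k *\<^sub>R v k)"
      by (rule combination_of_combinations) (erule A)
    then show ?thesis
      unfolding c affine_coords_def by (simp add: shift_def scaleR_add_left sum.distrib add_ac)
  qed
  have "{x \<in> {..<d} \<rightarrow>\<^sub>E UNIV. affine_coords d p' v' x \<in> P}
      = {x \<in> {..<d} \<rightarrow>\<^sub>E UNIV. shift {..<d} (matrix_map {..<d} A x) (\<lambda>k. of_int (c k)) \<in> ?S}"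
    unfolding coords by (auto simp: shift_def)
  then have "measure (lebesgue_on_coords {..<d}) {x \<in> {..<d} \<rightarrow>\<^sub>E UNIV. affine_coords d p' v' x \<in> P}
      = measure (lebesgue_on_coords {..<d}) ?S"
    using emeasure_unimodular_preimage[OF finite_lessThan inv inv' S, of "\<lambda>k. of_int (c k)"]
    by (simp add: measure_def)
  then show "s = r" using s r d' by simp
qed

section \<open>The slice of a flow cone at height one\<close>

text \<open>
  A vertex other than the source \<open>s\<close> may send out less than it receives; in the flow polytope the
  difference goes to the sink.
\<close>

definition flow_cone :: "('a \<Rightarrow> nat) \<Rightarrow> ('a \<Rightarrow> nat) \<Rightarrow> nat set \<Rightarrow> nat \<Rightarrow> 'a set \<Rightarrow> ('a \<Rightarrow> real) set" where
  "flow_cone src tgt V s A =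
     {g. (\<forall>a\<in>A. 0 \<le> g a) \<and> (\<forall>u\<in>V - {s}. arc_sum src A g u \<le> arc_sum tgt A g u)}"

lemma arc_sum_scale: "arc_sum src A (\<lambda>a. r * g a) u = r * arc_sum src A g u" for r :: real
  by (simp add: arc_sum_def sum_distrib_left)

lemma flow_cone_scale:
  assumes "0 < r"
  shows "(\<lambda>a. r * g a) \<in> flow_cone src tgt V s A \<longleftrightarrow> g \<in> flow_cone src tgt V s A"
  using assms by (simp add: flow_cone_def arc_sum_scale zero_le_mult_iff)

lemma flow_cone_cong:
  assumes "\<And>a. a \<in> A \<Longrightarrow> g a = g' a"
  shows "g \<in> flow_cone src tgt V s A \<longleftrightarrow> g' \<in> flow_cone src tgt V s A"
  using assms arc_sum_cong[of A g g'] by (simp add: flow_cone_def)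

text \<open>
  With a supply of \<open>1\<close> at the source and none elsewhere, the weight of \<open>network_weight\<close> is the
  exponential of minus the height, restricted to the cone.
\<close>

lemma network_weight_cone:
  assumes "finite V" "s \<in> V" and x: "\<And>a. a \<in> A \<Longrightarrow> 0 \<le> x a"
    and source: "\<And>a. a \<in> A \<Longrightarrow> tgt a \<noteq> s"
  shows "network_weight src tgt V A (\<lambda>u. if u = s then 1 else 0) x
    = (if x \<in> flow_cone src tgt V s A then exp (- arc_sum src A x s) else 0)"
proof -
  have in_s: "arc_sum tgt A x s = 0"
    using source by (auto simp: arc_sum_def intro!: sum.neutral)
  have out_s: "0 \<le> arc_sum src A x s" by (rule arc_sum_nonneg) (rule x)
  have "gamma_tail 1 (arc_sum src A x s) = exp (- arc_sum src A x s)"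
    using out_s by (auto simp: gamma_tail_def)
  moreover have "gamma_tail 0 t = (if t \<le> 0 then 1 else 0)" for t
    by (simp add: gamma_tail_def)
  moreover have "(\<Prod>u\<in>V - {s}. if arc_sum src A x u - arc_sum tgt A x u \<le> 0 then 1 else 0)
      = (if \<forall>u\<in>V - {s}. arc_sum src A x u \<le> arc_sum tgt A x u then 1 else (0::real))"
    using assms(1) by (auto simp: prod_zero_iff)
  moreover have "network_weight src tgt V A (\<lambda>u. if u = s then 1 else 0) x
      = gamma_tail 1 (arc_sum src A x s)
        * (\<Prod>u\<in>V - {s}. gamma_tail 0 (arc_sum src A x u - arc_sum tgt A x u))"
    unfolding network_weight_def using assms(1,2)
    by (subst prod.remove[of V s]) (auto simp: in_s intro!: prod.cong)
  ultimately show ?thesis using x by (simp add: flow_cone_def)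
qed

lemma sets_flow_cone:
  assumes "finite A" "finite V"
  shows "{x \<in> A \<rightarrow>\<^sub>E UNIV. x \<in> flow_cone src tgt V s A} \<in> sets (lebesgue_on_coords A)"
proof -
  have component: "(\<lambda>x. x a) \<in> borel_measurable (lebesgue_on_coords A)" if "a \<in> A" for a
    using measurable_component_singleton[OF that, of "\<lambda>_. lborel"] by (simp only: measurable_lborel1)
  have "{x \<in> space (lebesgue_on_coords A). (\<forall>a\<in>A. 0 \<le> x a) \<and>
      (\<forall>u\<in>V - {s}. arc_sum src A x u \<le> arc_sum tgt A x u)} \<in> sets (lebesgue_on_coords A)"
    using assms
    by (intro sets.sets_Collect_conj sets.sets_Collect_finite_All borel_measurable_le
        component borel_measurable_const borel_measurable_arc_sum) auto
  then show ?thesis by (simp add: flow_cone_def space_PiM)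
qed

text \<open>
  The value at the last arc \<open>d\<close>, which leaves \<open>s\<close>, is exchanged for the height \<open>r\<close> of the cone, that is
  for the outflow of \<open>s\<close>. The slice at height \<open>r\<close> is the slice at height \<open>1\<close> scaled by \<open>r\<close>, so that
  integrating \<open>exp (- height)\<close> over the cone gives \<open>fact d\<close> times the measure of the slice. By
  \<open>nn_integral_network_weight\<close> this integral is the number of network flows.
\<close>

theorem emeasure_flow_cone_slice:
  fixes src tgt :: "nat \<Rightarrow> nat" and d s :: nat and V :: "nat set"
  defines "A \<equiv> {..<Suc d}"
  assumes V: "finite V" "s \<in> V"
    and arcs: "\<And>a. a \<in> A \<Longrightarrow> src a \<in> V \<and> tgt a \<in> V \<and> src a < tgt a \<and> tgt a \<noteq> s"
    and reach: "\<And>u. u \<in> V - {s} \<Longrightarrow> \<exists>a\<in>A. tgt a = u"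
    and last: "src d = s"
  defines "slice \<equiv> {c \<in> {..<d} \<rightarrow>\<^sub>E UNIV.
      c(d := 1 - arc_sum src {..<d} c s) \<in> flow_cone src tgt V s A}"
  shows "slice \<in> sets (lebesgue_on_coords {..<d})"
    and "ennreal (fact d) * emeasure (lebesgue_on_coords {..<d}) slice
      = ennreal (card (network_flows src tgt V A (\<lambda>u. if u = s then 1 else 0)))"
proof -
  let ?M = "lebesgue_on_coords {..<d}" and ?k = "\<lambda>u. if u = s then 1 else 0 :: nat"
  define C where "C = {x \<in> A \<rightarrow>\<^sub>E UNIV. x \<in> flow_cone src tgt V s A}"
  define \<sigma> where "\<sigma> c = arc_sum src {..<d} c s" for c :: "nat \<Rightarrow> real"
  define I where "I r c = (indicator C (c(d := r - \<sigma> c)) :: ennreal)" for r c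
  interpret P: product_sigma_finite "\<lambda>_. lborel :: real measure" ..
  interpret M: sigma_finite_measure ?M by (rule sigma_finite_lebesgue_on_coords) simp
  interpret MP: pair_sigma_finite ?M "lborel :: real measure" ..
  have fin: "finite A" by (simp add: A_def)
  have A_insert: "A = insert d {..<d}" by (auto simp: A_def)
  have C: "C \<in> sets (lebesgue_on_coords A)"
    unfolding C_def by (rule sets_flow_cone[OF fin V(1)])
  have \<sigma>: "\<sigma> \<in> borel_measurable ?M"
    unfolding \<sigma>_def by (rule borel_measurable_arc_sum)
  have upd: "(\<lambda>p. (fst p)(d := h p)) \<in> measurable (?M \<Otimes>\<^sub>M lborel) (lebesgue_on_coords A)"
    if "h \<in> borel_measurable (?M \<Otimes>\<^sub>M lborel)" for h
    by (rule measurable_fun_upd[where J = "{..<d}"])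
       (use that in \<open>auto simp: A_insert intro: measurable_fst\<close>)
  have height: "(\<lambda>p. snd p - \<sigma> (fst p)) \<in> borel_measurable (?M \<Otimes>\<^sub>M lborel)"
    using measurable_compose[OF measurable_fst \<sigma>, of lborel] measurable_snd[of ?M lborel]
    by (intro borel_measurable_diff) simp_all
  have I_meas: "(\<lambda>p. I (snd p) (fst p)) \<in> borel_measurable (?M \<Otimes>\<^sub>M lborel)"
    unfolding I_def
    by (rule measurable_compose[OF upd[OF height]]) (rule borel_measurable_indicator[OF C])
  have I_meas_c: "I r \<in> borel_measurable ?M" for r
    using measurable_compose[OF measurable_Pair2'[of r lborel ?M] I_meas] by (simp add: fst_conv)
  have space: "c(d := y) \<in> A \<rightarrow>\<^sub>E UNIV" if "c \<in> space ?M" for c y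
    using that by (auto simp: space_PiM A_insert)
  have slice: "slice = {c \<in> space ?M. c(d := 1 - \<sigma> c) \<in> C}"
    using space[unfolded space_PiM] by (auto simp: slice_def C_def \<sigma>_def space_PiM)
  show sets: "slice \<in> sets ?M"
  proof -
    have "(\<lambda>c. c(d := 1 - \<sigma> c)) \<in> measurable ?M (lebesgue_on_coords A)"
      by (rule measurable_fun_upd[where J = "{..<d}"])
         (use \<sigma> in \<open>auto simp: A_insert intro: borel_measurable_diff\<close>)
    from measurable_sets[OF this C] show ?thesis
      unfolding slice by (auto simp: vimage_def Int_def conj_commute)
  qed
  have slice_integral: "(\<integral>\<^sup>+c. I 1 c \<partial>?M) = emeasure ?M slice"
  proof -
    have "(\<integral>\<^sup>+c. I 1 c \<partial>?M) = (\<integral>\<^sup>+c. indicator slice c \<partial>?M)"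
      by (intro nn_integral_cong) (simp add: I_def slice indicator_def)
    then show ?thesis using sets by simp
  qed
  have out_s: "arc_sum src A (c(d := y)) s = y + \<sigma> c" for c y
    using last by (simp add: A_insert arc_sum_insert \<sigma>_def)
  have scaled: "(\<integral>\<^sup>+c. I r c \<partial>?M) = ennreal (r ^ d) * emeasure ?M slice * indicator {0..} r"
    if "r \<noteq> 0" for r
  proof (cases "0 < r")
    case True
    have "(\<integral>\<^sup>+c. I r c \<partial>?M) = ennreal (r ^ d) * (\<integral>\<^sup>+c. I r (\<lambda>i\<in>{..<d}. 0 + r * c i) \<partial>?M)"
      using nn_integral_coords_affine[OF _ I_meas_c that, of r "\<lambda>_. 0"] True by simp
    also have "(\<integral>\<^sup>+c. I r (\<lambda>i\<in>{..<d}. 0 + r * c i) \<partial>?M) = (\<integral>\<^sup>+c. I 1 c \<partial>?M)"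
    proof (rule nn_integral_cong)
      fix c assume c: "c \<in> space ?M"
      let ?c = "\<lambda>i\<in>{..<d}. 0 + r * c i"
      have "\<sigma> ?c = arc_sum src {..<d} (\<lambda>i. r * c i) s"
        unfolding \<sigma>_def by (rule arc_sum_cong) simp
      then have \<sigma>c: "\<sigma> ?c = r * \<sigma> c" by (simp add: arc_sum_scale \<sigma>_def)
      have "?c(d := r - \<sigma> ?c) \<in> flow_cone src tgt V s A
          \<longleftrightarrow> (\<lambda>a. r * (c(d := 1 - \<sigma> c)) a) \<in> flow_cone src tgt V s A"
        unfolding \<sigma>c by (rule flow_cone_cong) (auto simp: A_insert algebra_simps)
      also have "\<dots> \<longleftrightarrow> c(d := 1 - \<sigma> c) \<in> flow_cone src tgt V s A"
        by (rule flow_cone_scale[OF True])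
      finally show "I r ?c = I 1 c"
        using space[OF c] space[of ?c] by (simp add: I_def C_def indicator_def space_PiM)
    qed
    finally show ?thesis using True by (simp add: slice_integral)
  next
    case False
    have "I r c = 0" for c
    proof -
      have "c(d := r - \<sigma> c) \<notin> flow_cone src tgt V s A"
      proof
        assume "c(d := r - \<sigma> c) \<in> flow_cone src tgt V s A"
        then have "0 \<le> arc_sum src A (c(d := r - \<sigma> c)) s"
          by (intro arc_sum_nonneg) (auto simp: flow_cone_def)
        then show False using False that by (simp add: out_s)
      qed
      then show ?thesis by (simp add: I_def C_def)
    qed
    then show ?thesis using False that by (simp add: indicator_def)
  qed
  have weight: "ennreal (network_weight src tgt V A ?k x) * indicator {x. \<forall>a\<in>A. 0 \<le> x a} x
      = ennreal (exp (- arc_sum src A x s)) * indicator C x" if "x \<in> A \<rightarrow>\<^sub>E UNIV" for x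
  proof (cases "\<forall>a\<in>A. 0 \<le> x a")
    case True
    have "network_weight src tgt V A ?k x
        = (if x \<in> flow_cone src tgt V s A then exp (- arc_sum src A x s) else 0)"
      using True arcs by (intro network_weight_cone V) auto
    with True that show ?thesis by (simp add: C_def)
  next
    case False
    then have "x \<notin> C" by (auto simp: C_def flow_cone_def)
    with False show ?thesis by simp
  qed
  have reach_card: "0 < ?k u + card {a \<in> A. tgt a = u}" if "u \<in> V" for u
  proof (cases "u = s")
    case False
    then have "{a \<in> A. tgt a = u} \<noteq> {}" using reach[of u] that by auto
    then show ?thesis using fin by (simp add: card_gt_0_iff)
  qed simp
  have count: "(\<integral>\<^sup>+x. ennreal (network_weight src tgt V A ?k x) * indicator {x. \<forall>a\<in>A. 0 \<le> x a} x
        \<partial>lebesgue_on_coords A) = ennreal (card (network_flows src tgt V A ?k))"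
    using nn_integral_network_weight[OF fin V(1), of src tgt ?k] arcs reach_card by simp
  have exp_meas: "(\<lambda>x. ennreal (exp (- arc_sum src A x s)) * indicator C x)
      \<in> borel_measurable (lebesgue_on_coords A)"
    using C borel_measurable_arc_sum[of src A s]
    by (intro borel_measurable_times_ennreal borel_measurable_indicator) auto
  have "ennreal (card (network_flows src tgt V A ?k))
      = (\<integral>\<^sup>+x. ennreal (exp (- arc_sum src A x s)) * indicator C x \<partial>lebesgue_on_coords A)"
    unfolding count[symmetric] by (intro nn_integral_cong weight) (simp add: space_PiM)
  also have "\<dots> = (\<integral>\<^sup>+c. (\<integral>\<^sup>+y. ennreal (exp (- (y + \<sigma> c))) * indicator C (c(d := y)) \<partial>lborel) \<partial>?M)"
    using P.product_nn_integral_insert[OF finite_lessThan, of d d, OF _ exp_meas[unfolded A_insert]]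
    by (simp only: A_insert[symmetric] out_s) simp
  also have "\<dots> = (\<integral>\<^sup>+c. (\<integral>\<^sup>+r. ennreal (exp (- r)) * I r c \<partial>lborel) \<partial>?M)"
  proof (rule nn_integral_cong)
    fix c assume c: "c \<in> space ?M"
    have "(\<lambda>p. indicator C ((fst p)(d := snd p)) :: ennreal) \<in> borel_measurable (?M \<Otimes>\<^sub>M lborel)"
      by (rule measurable_compose[OF upd]) (use borel_measurable_indicator[OF C] in auto)
    from measurable_compose[OF measurable_Pair1'[OF c, of lborel] this]
    have "(\<lambda>y. ennreal (exp (- (y + \<sigma> c))) * indicator C (c(d := y))) \<in> borel_measurable borel"
      by (intro borel_measurable_times_ennreal) (simp_all only: fst_conv snd_conv measurable_lborel2, measurable)
    from nn_integral_real_affine[OF this, of 1 "- \<sigma> c"]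
    show "(\<integral>\<^sup>+y. ennreal (exp (- (y + \<sigma> c))) * indicator C (c(d := y)) \<partial>lborel)
        = (\<integral>\<^sup>+r. ennreal (exp (- r)) * I r c \<partial>lborel)"
      by (simp add: I_def)
  qed
  also have "\<dots> = (\<integral>\<^sup>+r. (\<integral>\<^sup>+c. ennreal (exp (- r)) * I r c \<partial>?M) \<partial>lborel)"
  proof (rule MP.Fubini'[symmetric])
    have "(\<lambda>p. ennreal (exp (- snd p)) * I (snd p) (fst p)) \<in> borel_measurable (?M \<Otimes>\<^sub>M lborel)"
      using measurable_snd[of ?M lborel] by (intro borel_measurable_times_ennreal I_meas) simp
    then show "(\<lambda>(c, r). ennreal (exp (- r)) * I r c) \<in> borel_measurable (?M \<Otimes>\<^sub>M lborel)"
      by (simp only: case_prod_beta')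
  qed
  also have "\<dots> = (\<integral>\<^sup>+r. (ennreal (r ^ d * exp (- r)) * indicator {0..} r) * emeasure ?M slice \<partial>lborel)"
  proof (rule nn_integral_cong_AE, rule AE_mp[OF AE_lborel_singleton[of 0]], rule AE_I2, rule impI)
    fix r :: real assume r: "r \<noteq> 0"
    have "(\<integral>\<^sup>+c. ennreal (exp (- r)) * I r c \<partial>?M) = ennreal (exp (- r)) * (\<integral>\<^sup>+c. I r c \<partial>?M)"
      by (rule nn_integral_cmult[OF I_meas_c])
    also have "\<dots> = (ennreal (r ^ d * exp (- r)) * indicator {0..} r) * emeasure ?M slice"
      unfolding scaled[OF r] by (cases "0 \<le> r") (simp_all add: ennreal_mult mult_ac)
    finally show "(\<integral>\<^sup>+c. ennreal (exp (- r)) * I r c \<partial>?M)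
        = (ennreal (r ^ d * exp (- r)) * indicator {0..} r) * emeasure ?M slice" .
  qed
  also have "\<dots> = ennreal (fact d) * emeasure ?M slice"
    by (subst nn_integral_multc) (simp_all add: nn_intergal_power_times_exp_Ici)
  finally show "ennreal (fact d) * emeasure ?M slice
      = ennreal (card (network_flows src tgt V A ?k))" ..
qed

section \<open>A lattice frame of the flow polytope\<close>

lemma lookup_scaleR: "Poly_Mapping.lookup (r *\<^sub>R f) a = r *\<^sub>R Poly_Mapping.lookup f a"
proof -
  have "finite {i. r *\<^sub>R Poly_Mapping.lookup f i \<noteq> 0}"
    by (rule finite_subset[OF _ finite_lookup[of f]]) auto
  then show ?thesis by (simp add: scaleR_poly_mapping_def Abs_poly_mapping_inverse)
qed

lemma lookup_combination:
  "Poly_Mapping.lookup (\<Sum>i\<in>I. c i *\<^sub>R w i) a = (\<Sum>i\<in>I. c i *\<^sub>R Poly_Mapping.lookup (w i) a)"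
  by (simp add: lookup_sum lookup_scaleR)

type_synonym arc = "(nat \<times> nat) \<times> nat"

text \<open>The arcs that do not end in the sink; flows are determined by their values on these.\<close>

definition inner_arcs :: "nat \<Rightarrow> (nat \<times> nat) multiset \<Rightarrow> arc set" where
  "inner_arcs n E = edges E \<union> (\<lambda>i. ((0, i), 0)) ` {1..n + 1}"

definition sink_arc :: "nat \<Rightarrow> nat \<Rightarrow> arc" where
  "sink_arc n u = ((u, n + 2), 0)"

lemma fst_in_edges: "a \<in> edges E \<Longrightarrow> fst a \<in># E"
  by (auto simp: edges_def) (metis count_greater_zero_iff gr0I not_less0)

lemma edges_eq_Sigma: "edges E = (SIGMA e:set_mset E. {..<count E e})"
  using fst_in_edges[of _ E] by (force simp: edges_def)

lemma finite_edges: "finite (edges E)"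
  by (simp add: edges_eq_Sigma)

lemma finite_inner_arcs: "finite (inner_arcs n E)"
  by (simp add: inner_arcs_def finite_edges)

lemma arc_endpoints:
  assumes "multigraph_on {1..n + 1} E" "a \<in> inner_arcs n E"
  shows "fst (fst a) < snd (fst a)" "1 \<le> snd (fst a)" "snd (fst a) \<le> n + 1"
proof -
  have "fst (fst a) < snd (fst a) \<and> 1 \<le> snd (fst a) \<and> snd (fst a) \<le> n + 1"
  proof (cases "a \<in> edges E")
    case True
    then show ?thesis
      using assms(1) fst_in_edges[of a E] by (cases "fst a") (auto simp: multigraph_on_def)
  qed (use assms(2) in \<open>auto simp: inner_arcs_def\<close>)
  then show "fst (fst a) < snd (fst a)" "1 \<le> snd (fst a)" "snd (fst a) \<le> n + 1" by auto
qed

lemma edge_source_pos: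
  assumes "multigraph_on {1..n + 1} E" "a \<in> edges E"
  shows "1 \<le> fst (fst a)"
  using assms(1) fst_in_edges[OF assms(2)] by (cases "fst a") (auto simp: multigraph_on_def)

lemma edges_tilde_edges:
  assumes "multigraph_on {1..n + 1} E"
  shows "edges (tilde_edges n E) = inner_arcs n E \<union> sink_arc n ` {1..n + 1}"
proof -
  have E: "count E (0, i) = 0" "count E (i, n + 2) = 0" for i
    using assms by (auto simp: multigraph_on_def count_eq_zero_iff)
  have "count (tilde_edges n E) e = count E e
      + (if e \<in> (\<lambda>i. (0, i)) ` {1..n + 1} then 1 else 0)
      + (if e \<in> (\<lambda>i. (i, n + 2)) ` {1..n + 1} then 1 else 0)" for e
    by (simp add: tilde_edges_def count_mset_set')
  then have "edges (tilde_edges n E) = {(e, k). k < count E e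
      + (if e \<in> (\<lambda>i. (0, i)) ` {1..n + 1} then 1 else 0)
      + (if e \<in> (\<lambda>i. (i, n + 2)) ` {1..n + 1} then 1 else 0)}"
    by (simp add: edges_def)
  also have "\<dots> = {(e, k). k < count E e}
      \<union> (\<lambda>i. ((0, i), 0)) ` {1..n + 1} \<union> sink_arc n ` {1..n + 1}"
  proof (rule set_eqI)
    fix a :: arc
    obtain i j k where a: "a = ((i, j), k)" by (metis prod.exhaust)
    show "a \<in> {(e, k). k < count E e
      + (if e \<in> (\<lambda>i. (0, i)) ` {1..n + 1} then 1 else 0)
      + (if e \<in> (\<lambda>i. (i, n + 2)) ` {1..n + 1} then 1 else 0)}
      \<longleftrightarrow> a \<in> {(e, k). k < count E e} \<union> (\<lambda>i. ((0, i), 0)) ` {1..n + 1} \<union> sink_arc n ` {1..n + 1}"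
    proof (cases "i = 0 \<or> j = n + 2")
      case True
      then have "count E (i, j) = 0" using E by auto
      then show ?thesis using True by (auto simp: a sink_arc_def)
    qed (auto simp: a sink_arc_def)
  qed
  finally show ?thesis by (simp add: inner_arcs_def edges_def)
qed

lemma affine_add_combination:
  fixes x :: "'v::real_vector"
  assumes "affine S" "x \<in> S" "finite I"
    and "\<And>i. i \<in> I \<Longrightarrow> y i \<in> S \<and> z i \<in> S"
  shows "x + (\<Sum>i\<in>I. c i *\<^sub>R (y i - z i)) \<in> S"
  using assms(3,4)
proof (induction I rule: finite_induct)
  case empty
  show ?case using assms(2) by simp
next
  case (insert i I)
  have "x + (\<Sum>i\<in>I. c i *\<^sub>R (y i - z i)) \<in> S"
    by (rule insert.IH) (rule insert.prems, rule insertI2)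
  then have "(x + (\<Sum>i\<in>I. c i *\<^sub>R (y i - z i))) + c i *\<^sub>R (y i - z i) \<in> S"
    using insert.prems[OF insertI1] by (intro mem_affine_3_minus[OF assms(1)]) simp_all
  then show ?case
    unfolding sum.insert[OF insert.hyps] by (simp only: ac_simps)
qed

text \<open>
  The coordinates of a lattice frame are numbered, so the inner arcs are numbered by \<open>h\<close>. The last one,
  from the source to the vertex \<open>n + 1\<close>, is the arc whose value is determined by the condition that the
  source sends out \<open>1\<close>.
\<close>

locale enumerated_flow =
  fixes n :: nat and E :: "(nat \<times> nat) multiset" and d :: nat and h :: "nat \<Rightarrow> arc"
  assumes graph: "multigraph_on {1..n + 1} E"
    and h: "bij_betw h {..<Suc d} (inner_arcs n E)"
    and h_last: "h d = ((0, n + 1), 0)"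
begin

definition src :: "nat \<Rightarrow> nat" where "src k = fst (fst (h k))"
definition tgt :: "nat \<Rightarrow> nat" where "tgt k = snd (fst (h k))"

abbreviation "arcs \<equiv> {..<Suc d}"
abbreviation "V \<equiv> {0..n + 1}"
abbreviation "P \<equiv> flow_polytope (tilde_vertices n) (tilde_edges n E)"

lemma h_in: "k \<in> arcs \<Longrightarrow> h k \<in> inner_arcs n E"
  using h by (auto simp: bij_betw_def)

lemma h_eq_iff: "k \<in> arcs \<Longrightarrow> l \<in> arcs \<Longrightarrow> h k = h l \<longleftrightarrow> k = l"
  using h by (auto simp: bij_betw_def inj_on_def)

lemma arc_bounds:
  assumes "k \<in> arcs"
  shows "src k < tgt k" "1 \<le> tgt k" "tgt k \<le> n + 1" "src k \<le> n + 1"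
  using arc_endpoints[OF graph h_in[OF assms]] by (auto simp: src_def tgt_def)

lemma h_not_sink: "k \<in> arcs \<Longrightarrow> h k \<noteq> sink_arc n u"
  using arc_bounds(3)[of k] by (auto simp: tgt_def sink_arc_def)

lemma source_arc:
  assumes "i \<in> {1..n + 1}"
  obtains k where "k \<in> arcs" "h k = ((0, i), 0)"
proof -
  have "((0, i), 0) \<in> h ` arcs"
    using h assms by (auto simp: bij_betw_def inner_arcs_def)
  then show thesis using that by force
qed

text \<open>
  A unit of flow on arc \<open>k\<close> goes on to the sink from the final vertex of \<open>k\<close>. Unless \<open>k\<close> starts at the
  source, it is diverted from the arc that leads from the initial vertex of \<open>k\<close> to the sink, so that
  flow is conserved at all inner vertices.
\<close>

definition route :: "nat \<Rightarrow> arc \<Rightarrow>\<^sub>0 real" where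
  "route k = Poly_Mapping.single (h k) 1 + Poly_Mapping.single (sink_arc n (tgt k)) 1
     - (if src k = 0 then 0 else Poly_Mapping.single (sink_arc n (src k)) 1)"

definition flow_of :: "(nat \<Rightarrow> real) \<Rightarrow> arc \<Rightarrow>\<^sub>0 real" where
  "flow_of g = (\<Sum>k\<in>arcs. g k *\<^sub>R route k)"

lemma lookup_route_arc:
  assumes "k \<in> arcs" "l \<in> arcs"
  shows "Poly_Mapping.lookup (route k) (h l) = (if k = l then 1 else 0)"
proof -
  have "sink_arc n u \<noteq> h l" for u using h_not_sink[OF assms(2), of u] by simp
  then show ?thesis
    using h_eq_iff[OF assms] by (auto simp: route_def lookup_add lookup_minus lookup_single when_def)
qed

lemma lookup_route_sink:
  assumes "k \<in> arcs" "1 \<le> u"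
  shows "Poly_Mapping.lookup (route k) (sink_arc n u)
    = (if tgt k = u then 1 else 0) - (if src k = u then 1 else 0)"
  using h_not_sink[OF assms(1), of u] assms(2)
  by (auto simp: route_def lookup_add lookup_minus lookup_single when_def sink_arc_def)

lemma lookup_route_other:
  assumes "k \<in> arcs" "b \<notin> edges (tilde_edges n E)"
  shows "Poly_Mapping.lookup (route k) b = 0"
proof -
  have "h k \<noteq> b" using h_in[OF assms(1)] assms(2) by (auto simp: edges_tilde_edges[OF graph])
  moreover have "sink_arc n (tgt k) \<noteq> b" "src k \<noteq> 0 \<Longrightarrow> sink_arc n (src k) \<noteq> b"
    using arc_bounds[OF assms(1)] assms(2) by (auto simp: edges_tilde_edges[OF graph])
  ultimately show ?thesis
    by (auto simp: route_def lookup_add lookup_minus lookup_single when_def)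
qed

lemma lookup_flow_of_arc: "l \<in> arcs \<Longrightarrow> Poly_Mapping.lookup (flow_of g) (h l) = g l"
proof -
  assume l: "l \<in> arcs"
  have "Poly_Mapping.lookup (flow_of g) (h l) = (\<Sum>k\<in>arcs. if k = l then g k else 0)"
    unfolding flow_of_def lookup_combination
    by (intro sum.cong refl) (auto simp: lookup_route_arc[OF _ l])
  then show ?thesis using l by simp
qed

lemma lookup_flow_of_sink:
  assumes "1 \<le> u"
  shows "Poly_Mapping.lookup (flow_of g) (sink_arc n u) = arc_sum tgt arcs g u - arc_sum src arcs g u"
proof -
  have "Poly_Mapping.lookup (flow_of g) (sink_arc n u)
      = (\<Sum>k\<in>arcs. (if tgt k = u then g k else 0) - (if src k = u then g k else 0))"
    unfolding flow_of_def lookup_combination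
    by (intro sum.cong refl) (simp add: lookup_route_sink[OF _ assms])
  then show ?thesis
    by (simp only: sum_subtractf arc_sum_def sum.inter_filter[OF finite_lessThan])
qed

lemma lookup_flow_of_other:
  "b \<notin> edges (tilde_edges n E) \<Longrightarrow> Poly_Mapping.lookup (flow_of g) b = 0"
  unfolding flow_of_def lookup_combination by (simp add: lookup_route_other)

lemma edge_cases:
  assumes "b \<in> edges (tilde_edges n E)"
  obtains l where "l \<in> arcs" "b = h l" | u where "1 \<le> u" "u \<le> n + 1" "b = sink_arc n u"
  using assms h by (auto simp: edges_tilde_edges[OF graph] bij_betw_def)

lemma inner_arcs_reindex:
  "(\<Sum>a\<in>{a \<in> inner_arcs n E. Q a}. F a) = (\<Sum>k\<in>{k \<in> arcs. Q (h k)}. F (h k))"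
proof (rule sum.reindex_bij_betw[symmetric])
  show "bij_betw h {k \<in> arcs. Q (h k)} {a \<in> inner_arcs n E. Q a}"
    unfolding bij_betw_def
  proof
    show "inj_on h {k \<in> arcs. Q (h k)}"
      using h by (auto simp: bij_betw_def inj_on_def)
    have "inner_arcs n E = h ` arcs" using h by (simp add: bij_betw_def)
    then show "h ` {k \<in> arcs. Q (h k)} = {a \<in> inner_arcs n E. Q a}"
      by (simp only: Compr_image_eq)
  qed
qed

abbreviation on_arcs :: "(arc \<Rightarrow>\<^sub>0 real) \<Rightarrow> nat \<Rightarrow> real" where
  "on_arcs f k \<equiv> Poly_Mapping.lookup f (h k)"

lemma outflow_tilde:
  assumes "u \<le> n + 1"
  shows "outflow (tilde_edges n E) f u = arc_sum src arcs (on_arcs f) u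
    + (if u = 0 then 0 else Poly_Mapping.lookup f (sink_arc n u))"
proof -
  have eq: "{a \<in> edges (tilde_edges n E). fst (fst a) = u}
      = {a \<in> inner_arcs n E. fst (fst a) = u} \<union> (if u = 0 then {} else {sink_arc n u})"
    using assms by (auto simp: edges_tilde_edges[OF graph] sink_arc_def)
  have "sink_arc n u \<notin> inner_arcs n E"
    using arc_endpoints(3)[OF graph, of "sink_arc n u"] by (auto simp: sink_arc_def)
  then show ?thesis
    unfolding outflow_def eq
    by (subst sum.union_disjoint)
       (auto simp: finite_inner_arcs inner_arcs_reindex arc_sum_def src_def)
qed

lemma inflow_tilde:
  assumes "u \<le> n + 1"
  shows "inflow (tilde_edges n E) f u = arc_sum tgt arcs (on_arcs f) u"
proof -
  have eq: "{a \<in> edges (tilde_edges n E). snd (fst a) = u} = {a \<in> inner_arcs n E. snd (fst a) = u}"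
    using assms by (auto simp: edges_tilde_edges[OF graph] sink_arc_def)
  show ?thesis unfolding inflow_def eq inner_arcs_reindex by (simp add: arc_sum_def tgt_def)
qed

lemma inflow_sink:
  "inflow (tilde_edges n E) f (n + 2) = (\<Sum>u\<in>{1..n + 1}. Poly_Mapping.lookup f (sink_arc n u))"
proof -
  have "{a \<in> edges (tilde_edges n E). snd (fst a) = n + 2} = sink_arc n ` {1..n + 1}"
    using arc_endpoints(3)[OF graph] by (fastforce simp: edges_tilde_edges[OF graph] sink_arc_def)
  moreover have "inj_on (sink_arc n) {1..n + 1}" by (auto simp: inj_on_def sink_arc_def)
  ultimately show ?thesis by (simp add: inflow_def sum.reindex)
qed

text \<open>
  Every arc has exactly one final vertex in \<open>{1..n + 1}\<close> and one initial vertex in \<open>{0..n + 1}\<close>. So what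
  reaches the sink is what leaves the source.
\<close>

lemma total_excess:
  fixes g :: "nat \<Rightarrow> real"
  shows "(\<Sum>u\<in>{1..n + 1}. arc_sum tgt arcs g u - arc_sum src arcs g u) = arc_sum src arcs g 0"
proof -
  have "(\<Sum>u\<in>{1..n + 1}. arc_sum tgt arcs g u) = (\<Sum>k\<in>arcs. g k)"
    unfolding arc_sum_def
    by (intro sum.group image_subsetI finite_lessThan finite_atLeastAtMost)
       (simp only: atLeastAtMost_iff arc_bounds)
  moreover have "(\<Sum>u\<in>{0..n + 1}. arc_sum src arcs g u) = (\<Sum>k\<in>arcs. g k)"
    unfolding arc_sum_def
    by (intro sum.group image_subsetI finite_lessThan finite_atLeastAtMost)
       (simp only: atLeastAtMost_iff arc_bounds le0)
  moreover have "(\<Sum>u\<in>{0..n + 1}. arc_sum src arcs g u)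
      = arc_sum src arcs g 0 + (\<Sum>u\<in>{1..n + 1}. arc_sum src arcs g u)"
    by (subst sum.atLeast_Suc_atMost) (simp_all only: le0 One_nat_def)
  ultimately show ?thesis unfolding sum_subtractf by linarith
qed

lemma vertices: "Min (tilde_vertices n) = 0" "Max (tilde_vertices n) = n + 2"
  "tilde_vertices n - {0, n + 2} = {1..n + 1}"
proof -
  show "Min (tilde_vertices n) = 0" by (rule Min_eqI) (auto simp: tilde_vertices_def)
  show "Max (tilde_vertices n) = n + 2" by (rule Max_eqI) (auto simp: tilde_vertices_def)
  show "tilde_vertices n - {0, n + 2} = {1..n + 1}" by (auto simp: tilde_vertices_def)
qed

text \<open>
  Conservation at \<open>u\<close> determines the value at the arc from \<open>u\<close> to the sink.
\<close>

lemma flow_of_on_arcs: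
  assumes "Poly_Mapping.keys f \<subseteq> edges (tilde_edges n E)"
    and "\<And>u. u \<in> {1..n + 1} \<Longrightarrow> inflow (tilde_edges n E) f u = outflow (tilde_edges n E) f u"
  shows "f = flow_of (on_arcs f)"
proof (rule poly_mapping_eqI)
  fix b
  show "Poly_Mapping.lookup f b = Poly_Mapping.lookup (flow_of (on_arcs f)) b"
  proof (cases "b \<in> edges (tilde_edges n E)")
    case True
    then show ?thesis
    proof (cases rule: edge_cases)
      case (1 l)
      then show ?thesis by (simp only: lookup_flow_of_arc)
    next
      case (2 u)
      then show ?thesis
        using assms(2)[of u] by (simp add: lookup_flow_of_sink inflow_tilde outflow_tilde)
    qed
  next
    case False
    then have "b \<notin> Poly_Mapping.keys f" using assms(1) by blast
    then show ?thesis
      by (simp add: lookup_flow_of_other[OF False] in_keys_iff)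
  qed
qed

lemma flow_polytope_iff:
  "f \<in> P \<longleftrightarrow> (\<exists>g. f = flow_of g \<and> g \<in> flow_cone src tgt V 0 arcs \<and> arc_sum src arcs g 0 = 1)"
proof
  assume f: "f \<in> P"
  then have cons: "\<And>u. u \<in> {1..n + 1} \<Longrightarrow> inflow (tilde_edges n E) f u = outflow (tilde_edges n E) f u"
    and keys: "Poly_Mapping.keys f \<subseteq> edges (tilde_edges n E)"
    and nonneg: "\<And>a. a \<in> edges (tilde_edges n E) \<Longrightarrow> 0 \<le> Poly_Mapping.lookup f a"
    and unit: "outflow (tilde_edges n E) f 0 = 1"
    unfolding flow_polytope_def vertices by auto
  have "f = flow_of (on_arcs f)" by (rule flow_of_on_arcs[OF keys cons])
  moreover have "on_arcs f \<in> flow_cone src tgt V 0 arcs"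
    unfolding flow_cone_def
  proof (intro CollectI conjI ballI)
    fix k assume "k \<in> arcs"
    then show "0 \<le> on_arcs f k"
      using h_in by (intro nonneg) (auto simp: edges_tilde_edges[OF graph])
  next
    fix u assume u: "u \<in> V - {0}"
    then have "0 \<le> Poly_Mapping.lookup f (sink_arc n u)"
      by (intro nonneg) (auto simp: edges_tilde_edges[OF graph])
    then show "arc_sum src arcs (on_arcs f) u \<le> arc_sum tgt arcs (on_arcs f) u"
      using cons[of u] u by (simp add: inflow_tilde outflow_tilde)
  qed
  moreover have "arc_sum src arcs (on_arcs f) 0 = 1"
    using unit by (simp add: outflow_tilde)
  ultimately show "\<exists>g. f = flow_of g \<and> g \<in> flow_cone src tgt V 0 arcs \<and> arc_sum src arcs g 0 = 1"
    by blast
next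
  assume "\<exists>g. f = flow_of g \<and> g \<in> flow_cone src tgt V 0 arcs \<and> arc_sum src arcs g 0 = 1"
  then obtain g where f: "f = flow_of g" and cone: "g \<in> flow_cone src tgt V 0 arcs"
    and unit: "arc_sum src arcs g 0 = 1" by blast
  have on: "arc_sum s arcs (on_arcs f) u = arc_sum s arcs g u" for s u
    by (rule arc_sum_cong) (simp only: f lookup_flow_of_arc)
  have sink: "Poly_Mapping.lookup f (sink_arc n u) = arc_sum tgt arcs g u - arc_sum src arcs g u"
    if "u \<in> {1..n + 1}" for u
    using that by (simp add: f lookup_flow_of_sink)
  have "Poly_Mapping.keys f \<subseteq> edges (tilde_edges n E)"
    using lookup_flow_of_other[of _ g] by (force simp: in_keys_iff f)
  moreover have "0 \<le> Poly_Mapping.lookup f b" if "b \<in> edges (tilde_edges n E)" for b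
    using that
  proof (cases rule: edge_cases)
    case (1 l)
    then show ?thesis using cone by (simp only: f lookup_flow_of_arc flow_cone_def) blast
  next
    case (2 u)
    then show ?thesis using cone sink[of u] by (auto simp: flow_cone_def)
  qed
  moreover have "outflow (tilde_edges n E) f 0 = 1"
    using unit by (simp add: outflow_tilde on)
  moreover have "inflow (tilde_edges n E) f (n + 2) = 1"
    unfolding inflow_sink using total_excess[of g] unit by (simp only: sum.cong[OF refl sink])
  moreover have "inflow (tilde_edges n E) f u = outflow (tilde_edges n E) f u" if "u \<in> {1..n + 1}" for u
    using that by (simp add: inflow_tilde outflow_tilde on sink)
  ultimately show "f \<in> P" unfolding flow_polytope_def vertices by auto
qed

text \<open>
  Changing the value at \<open>k\<close> changes the outflow of the source if \<open>k\<close> starts there; arc \<open>d\<close> makes up for it.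
\<close>

definition direction :: "nat \<Rightarrow> arc \<Rightarrow>\<^sub>0 real" where
  "direction k = route k - (if src k = 0 then route d else 0)"

lemma src_last: "src d = 0" and d_in: "d \<in> arcs"
  by (simp_all add: src_def h_last)

lemma lookup_direction:
  assumes "k < d" "l < d"
  shows "Poly_Mapping.lookup (direction k) (h l) = (if k = l then 1 else 0)"
proof -
  have l: "l \<in> arcs" and "l \<noteq> d" using assms by auto
  moreover have "k \<in> arcs" "d \<in> arcs" using assms by auto
  ultimately show ?thesis
    using lookup_route_arc[of k l] lookup_route_arc[of d l] by (simp add: direction_def lookup_minus)
qed

lemma affine_coords_flow:
  "affine_coords d (route d) direction c = flow_of (c(d := 1 - arc_sum src {..<d} c 0))"
proof -
  have "(\<Sum>k<d. c k *\<^sub>R direction k)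
      = (\<Sum>k<d. c k *\<^sub>R route k) - (\<Sum>k<d. (if src k = 0 then c k else 0) *\<^sub>R route d)"
    unfolding sum_subtractf[symmetric]
    by (intro sum.cong refl) (simp add: direction_def scaleR_diff_right)
  also have "(\<Sum>k<d. (if src k = 0 then c k else 0) *\<^sub>R route d) = arc_sum src {..<d} c 0 *\<^sub>R route d"
    by (simp only: scaleR_sum_left[symmetric] arc_sum_def sum.inter_filter[OF finite_lessThan])
  finally show ?thesis
    by (simp add: affine_coords_def flow_of_def lessThan_Suc scaleR_diff_left)
qed

lemma range_affine_coords:
  "range (affine_coords d (route d) direction) = {flow_of g | g. arc_sum src arcs g 0 = 1}"
proof (intro equalityI subsetI)
  fix f assume "f \<in> range (affine_coords d (route d) direction)"
  then obtain c where f: "f = flow_of (c(d := 1 - arc_sum src {..<d} c 0))"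
    by (auto simp: affine_coords_flow)
  have "arc_sum src arcs (c(d := 1 - arc_sum src {..<d} c 0)) 0 = 1"
    by (simp add: lessThan_Suc arc_sum_insert src_last)
  with f show "f \<in> {flow_of g | g. arc_sum src arcs g 0 = 1}" by blast
next
  fix f assume "f \<in> {flow_of g | g. arc_sum src arcs g 0 = 1}"
  then obtain g where f: "f = flow_of g" and g: "arc_sum src arcs g 0 = 1" by blast
  have "g(d := 1 - arc_sum src {..<d} g 0) = g"
    using g by (simp add: lessThan_Suc arc_sum_insert src_last fun_eq_iff)
  then have "f = affine_coords d (route d) direction g" by (simp add: f affine_coords_flow)
  then show "f \<in> range (affine_coords d (route d) direction)" by simp
qed

lemma route_source_in_P:
  assumes "k \<in> arcs" "src k = 0"
  shows "route k \<in> P"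
proof -
  let ?g = "\<lambda>l. if l = k then 1 else 0 :: real"
  have sum: "arc_sum s arcs ?g u = (if s k = u then 1 else 0)" for s :: "nat \<Rightarrow> nat" and u
    using assms(1) by (simp add: arc_sum_def sum.inter_filter[OF finite_lessThan] if_distrib[of "\<lambda>x. if s _ = u then x else 0"] cong: if_cong)
  have "route k = flow_of ?g"
    using assms(1) by (simp add: flow_of_def if_distrib[of "\<lambda>x. x *\<^sub>R _"] cong: if_cong)
  moreover have "?g \<in> flow_cone src tgt V 0 arcs"
    using assms by (auto simp: flow_cone_def sum)
  moreover have "arc_sum src arcs ?g 0 = 1"
    using assms(2) by (simp only: sum) simp
  ultimately show ?thesis unfolding flow_polytope_iff by blast
qed

lemma route_pair_in_P:
  assumes "k \<in> arcs" "l \<in> arcs" "src l = 0" "tgt l = src k" "src k \<noteq> 0"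
  shows "route l + route k \<in> P"
proof -
  let ?g = "\<lambda>j. (if j = l then 1 else 0) + (if j = k then 1 else 0 :: real)"
  have one: "(\<Sum>j\<in>arcs. if s j = u then (if j = i then 1 else 0) else 0) = (if s i = u then 1 else 0 :: real)"
    if "i \<in> arcs" for s :: "nat \<Rightarrow> nat" and u i
  proof -
    have "(\<Sum>j\<in>arcs. if s j = u then (if j = i then 1 else 0) else 0)
        = (\<Sum>j\<in>arcs. if j = i then (if s i = u then 1 else 0) else 0 :: real)"
      by (intro sum.cong) auto
    then show ?thesis using that by simp
  qed
  have sum: "arc_sum s arcs ?g u = (if s l = u then 1 else 0) + (if s k = u then 1 else 0)"
    for s :: "nat \<Rightarrow> nat" and u
    unfolding one[OF assms(1), symmetric] one[OF assms(2), symmetric] sum.distrib[symmetric]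
      arc_sum_def sum.inter_filter[OF finite_lessThan]
    by (intro sum.cong) auto
  have pick: "(\<Sum>j\<in>arcs. (if j = i then 1 else 0) *\<^sub>R route j) = route i" if "i \<in> arcs" for i
  proof -
    have "(\<Sum>j\<in>arcs. (if j = i then 1 else 0) *\<^sub>R route j) = (\<Sum>j\<in>arcs. if j = i then route j else 0)"
      by (intro sum.cong) auto
    then show ?thesis using that by simp
  qed
  have "route l + route k = flow_of ?g"
    by (simp only: flow_of_def scaleR_add_left sum.distrib pick assms(1,2))
  moreover have "?g \<in> flow_cone src tgt V 0 arcs"
    using assms by (auto simp: flow_cone_def sum)
  moreover have "arc_sum src arcs ?g 0 = 1"
    using assms by (simp only: sum) simp
  ultimately show ?thesis unfolding flow_polytope_iff by blast
qed

text \<open>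
  The direction of an arc from the source is the difference of the paths from the source to the sink
  through that arc and through \<open>d\<close>. The direction of an arc from \<open>i\<close> to \<open>j\<close> is the difference of the
  paths through \<open>i, j\<close> and through \<open>i\<close> only. These paths are points of the polytope, so its affine hull
  contains the whole plane spanned by the directions.
\<close>

lemma direction_difference:
  assumes "k \<in> arcs"
  shows "\<exists>x\<in>P. \<exists>y\<in>P. direction k = x - y"
proof (cases "src k = 0")
  case True
  then show ?thesis
    using route_source_in_P[OF assms] route_source_in_P[OF d_in src_last]
    by (auto simp: direction_def)
next
  case False
  then obtain l where l: "l \<in> arcs" "h l = ((0, src k), 0)"
    using source_arc[of "src k"] arc_bounds(4)[OF assms] by auto
  then have "src l = 0" "tgt l = src k" by (simp_all add: src_def tgt_def)
  then have "route l + route k \<in> P" "route l \<in> P"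
    using route_pair_in_P[OF assms l(1)] route_source_in_P[OF l(1)] False by auto
  then show ?thesis using False by (intro bexI[of _ "route l + route k"] bexI[of _ "route l"]) (auto simp: direction_def)
qed

lemma affine_hull_flow_polytope:
  "affine hull P = range (affine_coords d (route d) direction)"
proof (rule subset_antisym)
  show "affine hull P \<subseteq> range (affine_coords d (route d) direction)"
  proof (rule hull_minimal)
    show "P \<subseteq> range (affine_coords d (route d) direction)"
      unfolding range_affine_coords
    proof
      fix f assume "f \<in> P"
      from iffD1[OF flow_polytope_iff this]
      obtain g where "f = flow_of g" "arc_sum src arcs g 0 = 1" by blast
      then show "f \<in> {flow_of g | g. arc_sum src arcs g 0 = 1}" by blast
    qed
    show "affine (range (affine_coords d (route d) direction))"
      unfolding affine_def
    proof (intro ballI allI impI)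
      fix x y and u v :: real
      assume "x \<in> range (affine_coords d (route d) direction)" "y \<in> range (affine_coords d (route d) direction)"
        and uv: "u + v = 1"
      then obtain a b where x: "x = affine_coords d (route d) direction a"
        and y: "y = affine_coords d (route d) direction b" by blast
      have "u *\<^sub>R x + v *\<^sub>R y = (u + v) *\<^sub>R route d
          + ((\<Sum>k<d. (u * a k) *\<^sub>R direction k) + (\<Sum>k<d. (v * b k) *\<^sub>R direction k))"
        by (simp add: x y affine_coords_def scaleR_add_right scaleR_add_left scaleR_sum_right add_ac)
      also have "\<dots> = affine_coords d (route d) direction (\<lambda>k. u * a k + v * b k)"
        by (simp add: uv affine_coords_def scaleR_add_left sum.distrib)
      finally show "u *\<^sub>R x + v *\<^sub>R y \<in> range (affine_coords d (route d) direction)" by simp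
    qed
  qed
  show "range (affine_coords d (route d) direction) \<subseteq> affine hull P"
  proof
    fix f assume "f \<in> range (affine_coords d (route d) direction)"
    then obtain c where f: "f = route d + (\<Sum>k\<in>{..<d}. c k *\<^sub>R direction k)"
      by (auto simp: affine_coords_def)
    have P: "P \<subseteq> affine hull P" by (rule hull_subset)
    show "f \<in> affine hull P"
      unfolding f
    proof -
      have "\<exists>y z. y \<in> P \<and> z \<in> P \<and> direction k = y - z" if "k \<in> {..<d}" for k
        using direction_difference[of k] that by auto
      then obtain y z where yz: "\<And>k. k \<in> {..<d} \<Longrightarrow> y k \<in> P \<and> z k \<in> P \<and> direction k = y k - z k"
        by metis
      have "(\<Sum>k\<in>{..<d}. c k *\<^sub>R direction k) = (\<Sum>k\<in>{..<d}. c k *\<^sub>R (y k - z k))"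
        using yz by (intro sum.cong refl) metis
      moreover have "route d + (\<Sum>k\<in>{..<d}. c k *\<^sub>R (y k - z k)) \<in> affine hull P"
        using yz P route_source_in_P[OF d_in src_last]
        by (intro affine_add_combination affine_affine_hull finite_lessThan) blast+
      ultimately show "route d + (\<Sum>k\<in>{..<d}. c k *\<^sub>R direction k) \<in> affine hull P"
        by (simp only:)
    qed
  qed
qed

lemma inj_direction: "inj_on direction {..<d}"
proof (rule inj_onI)
  fix k l assume "k \<in> {..<d}" "l \<in> {..<d}" and eq: "direction k = direction l"
  then have "Poly_Mapping.lookup (direction l) (h k) = 1" "k < d" "l < d"
    using lookup_direction[of k k] by auto
  then show "k = l" using lookup_direction[of l k] by (auto split: if_splits)
qed

lemma independent_direction: "independent (direction ` {..<d})"
proof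
  assume "dependent (direction ` {..<d})"
  then obtain u k where zero: "(\<Sum>v\<in>direction ` {..<d}. u v *\<^sub>R v) = 0"
    and k: "k < d" "u (direction k) \<noteq> 0"
    by (auto simp: real_vector.dependent_finite)
  have "0 = Poly_Mapping.lookup (\<Sum>i<d. u (direction i) *\<^sub>R direction i) (h k)"
    using zero by (simp add: sum.reindex[OF inj_direction])
  also have "\<dots> = (\<Sum>i<d. if i = k then u (direction i) else 0)"
    unfolding lookup_combination using k(1) by (intro sum.cong refl) (auto simp: lookup_direction)
  also have "\<dots> = u (direction k)" using k by simp
  finally show False using k by simp
qed

lemma integer_affine_coords:
  "affine hull P \<inter> integer_points
    = range (\<lambda>c :: nat \<Rightarrow> int. affine_coords d (route d) direction (\<lambda>k. of_int (c k)))"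
  unfolding affine_hull_flow_polytope
proof (intro equalityI subsetI)
  fix f assume f: "f \<in> range (affine_coords d (route d) direction) \<inter> integer_points"
  then obtain c where c: "f = affine_coords d (route d) direction c" by blast
  have "c k = of_int \<lfloor>c k\<rfloor>" if "k < d" for k
  proof -
    have "Poly_Mapping.lookup f (h k) = c k"
      using that by (simp add: c affine_coords_flow lookup_flow_of_arc)
    then have "c k \<in> \<int>" using f by (metis IntD2 integer_points_def mem_Collect_eq)
    then show ?thesis by (auto simp: Ints_def)
  qed
  then have "f = affine_coords d (route d) direction (\<lambda>k. of_int \<lfloor>c k\<rfloor>)"
    unfolding c affine_coords_def by (intro arg_cong2[where f = "(+)"] sum.cong refl) auto
  then show "f \<in> range (\<lambda>c :: nat \<Rightarrow> int. affine_coords d (route d) direction (\<lambda>k. of_int (c k)))"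
    by (rule range_eqI[where x = "\<lambda>k. \<lfloor>c k\<rfloor>"])
next
  fix f assume "f \<in> range (\<lambda>c :: nat \<Rightarrow> int. affine_coords d (route d) direction (\<lambda>k. of_int (c k)))"
  then obtain c :: "nat \<Rightarrow> int" where f: "f = affine_coords d (route d) direction (\<lambda>k. of_int (c k))" by blast
  have route: "Poly_Mapping.lookup (route k) b \<in> \<int>" for k b
    by (simp add: route_def lookup_add lookup_minus lookup_single when_def)
  have "Poly_Mapping.lookup (direction k) b \<in> \<int>" for k b
    using route by (simp add: direction_def lookup_minus)
  then have "Poly_Mapping.lookup f b \<in> \<int>" for b
    unfolding f affine_coords_def lookup_add lookup_combination real_scaleR_def
    by (intro Ints_add route Ints_sum Ints_mult Ints_of_int)
  then show "f \<in> range (affine_coords d (route d) direction) \<inter> integer_points"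
    by (simp add: f integer_points_def)
qed

lemma lattice_frame_flow_polytope: "lattice_frame P d (route d) direction"
  unfolding lattice_frame_def
  using inj_direction independent_direction affine_hull_flow_polytope integer_affine_coords by blast

lemma affine_coords_in_P_iff:
  "affine_coords d (route d) direction c \<in> P
    \<longleftrightarrow> c(d := 1 - arc_sum src {..<d} c 0) \<in> flow_cone src tgt V 0 arcs"
proof -
  let ?g = "c(d := 1 - arc_sum src {..<d} c 0)"
  have unit: "arc_sum src arcs ?g 0 = 1"
    by (simp add: lessThan_Suc arc_sum_insert src_last)
  have "?g \<in> flow_cone src tgt V 0 arcs" if "flow_of ?g = flow_of g" "g \<in> flow_cone src tgt V 0 arcs" for g
  proof -
    have "?g k = g k" if "k \<in> arcs" for k
      using lookup_flow_of_arc[OF that, of ?g] lookup_flow_of_arc[OF that, of g] \<open>flow_of ?g = flow_of g\<close>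
      by simp
    then show ?thesis using flow_cone_cong[of arcs ?g g] that(2) by blast
  qed
  then show ?thesis unfolding affine_coords_flow flow_polytope_iff using unit by metis
qed

text \<open>
  In the coordinates of the frame the polytope is the slice of the flow cone at height \<open>1\<close>.
\<close>

theorem normalized_volume_network_flows:
  "normalized_volume P = card (network_flows src tgt V arcs (\<lambda>u. if u = 0 then 1 else 0))"
proof (rule normalized_volume_eqI[OF lattice_frame_flow_polytope])
  let ?S = "{c \<in> {..<d} \<rightarrow>\<^sub>E UNIV. affine_coords d (route d) direction c \<in> P}"
  let ?F = "network_flows src tgt V arcs (\<lambda>u. if u = 0 then 1 else 0)"
  have arcs: "src k \<in> V \<and> tgt k \<in> V \<and> src k < tgt k \<and> tgt k \<noteq> 0" if "k \<in> arcs" for k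
    using arc_bounds[OF that] by auto
  have reach: "\<exists>k\<in>arcs. tgt k = u" if u: "u \<in> V - {0}" for u
  proof -
    obtain k where "k \<in> arcs" "h k = ((0, u), 0)" using source_arc[of u] u by auto
    then show ?thesis by (intro bexI[of _ k]) (simp_all add: tgt_def)
  qed
  have S: "?S = {c \<in> {..<d} \<rightarrow>\<^sub>E UNIV.
      c(d := 1 - arc_sum src {..<d} c 0) \<in> flow_cone src tgt V 0 arcs}"
    by (simp only: affine_coords_in_P_iff)
  show "?S \<in> sets (lebesgue_on_coords {..<d})"
    unfolding S by (rule emeasure_flow_cone_slice(1)[OF _ _ arcs reach src_last]) simp_all
  have "ennreal (fact d) * emeasure (lebesgue_on_coords {..<d}) ?S = ennreal (card ?F)"
    unfolding S by (rule emeasure_flow_cone_slice(2)[OF _ _ arcs reach src_last]) simp_all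
  then have "enn2real (ennreal (fact d) * emeasure (lebesgue_on_coords {..<d}) ?S) = card ?F"
    by simp
  then show "real (card ?F) = fact d * measure (lebesgue_on_coords {..<d}) ?S"
    by (simp add: enn2real_mult measure_def)
qed

end

section \<open>Integer flows and triangular arrays\<close>

lemma card_edges: "card (edges E) = size E"
  by (simp add: edges_eq_Sigma size_multiset_overloaded_eq)

lemma card_edges_filter: "card {a \<in> edges E. Q (fst a)} = size (filter_mset Q E)"
proof -
  have "{a \<in> edges E. Q (fst a)} = edges (filter_mset Q E)"
    by (auto simp: edges_def split: if_splits)
  then show ?thesis by (simp add: card_edges)
qed

text \<open>
  The edges of the restriction to \<open>{1..i + 1}\<close> that are new are those with final vertex \<open>i + 1\<close>, since
  initial vertices are smaller. So the difference of the sizes is an indegree.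
\<close>

lemma size_restrict_graph_Suc:
  assumes "multigraph_on V E" "V \<subseteq> {1..}"
  shows "size (restrict_graph E (Suc i)) = size (restrict_graph E i) + size (filter_mset (\<lambda>e. snd e = Suc i) E)"
proof -
  have E: "1 \<le> fst e \<and> fst e < snd e" if "e \<in># E" for e
    using assms that by (cases e) (fastforce simp: multigraph_on_def)
  have "restrict_graph E (Suc i) = filter_mset (\<lambda>e. snd e \<le> Suc i) E"
    "restrict_graph E i = filter_mset (\<lambda>e. snd e \<le> i) E"
    unfolding restrict_graph_def using E by (force intro!: filter_mset_cong)+
  moreover have "filter_mset (\<lambda>e. snd e \<le> Suc i) E
      = filter_mset (\<lambda>e. snd e \<le> i) E + filter_mset (\<lambda>e. snd e = Suc i) E"
    by (rule multiset_eqI) auto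
  ultimately show ?thesis by simp
qed

context enumerated_flow
begin

definition arc_index :: "arc \<Rightarrow> nat" where
  "arc_index a = inv_into arcs h a"

lemma arc_index:
  assumes "a \<in> inner_arcs n E"
  shows "arc_index a \<in> arcs" "h (arc_index a) = a"
proof -
  have "a \<in> h ` arcs" using assms h by (simp add: bij_betw_def)
  then show "arc_index a \<in> arcs" "h (arc_index a) = a"
    unfolding arc_index_def by (rule inv_into_into, rule f_inv_into_f)
qed

lemma arc_index_h: "k \<in> arcs \<Longrightarrow> arc_index (h k) = k"
  unfolding arc_index_def using h by (intro inv_into_f_f) (auto simp: bij_betw_def)

lemma edge_arc:
  assumes "(u, v) \<in># E"
  shows "arc_index ((u, v), 0) \<in> arcs" "src (arc_index ((u, v), 0)) = u" "tgt (arc_index ((u, v), 0)) = v"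
proof -
  have "((u, v), 0) \<in> inner_arcs n E"
    using assms by (simp add: inner_arcs_def edges_def)
  then show "arc_index ((u, v), 0) \<in> arcs" "src (arc_index ((u, v), 0)) = u" "tgt (arc_index ((u, v), 0)) = v"
    using arc_index by (simp_all add: src_def tgt_def)
qed

text \<open>The successor accounts for the arc from the source to \<open>u\<close>.\<close>

lemma card_tgt:
  assumes "u \<in> {1..n + 1}"
  shows "card {k \<in> arcs. tgt k = u} = Suc (size (filter_mset (\<lambda>e. snd e = u) E))"
proof -
  have "card {k \<in> arcs. tgt k = u} = card {a \<in> inner_arcs n E. snd (fst a) = u}"
    using inner_arcs_reindex[of "\<lambda>_. 1 :: nat" "\<lambda>a. snd (fst a) = u"] by (simp add: tgt_def)
  also have "{a \<in> inner_arcs n E. snd (fst a) = u} = insert ((0, u), 0) {a \<in> edges E. snd (fst a) = u}"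
    using assms by (auto simp: inner_arcs_def)
  also have "card \<dots> = Suc (card {a \<in> edges E. snd (fst a) = u})"
    using edge_source_pos[OF graph, of "((0, u), 0)"]
    by (subst card_insert_disjoint) (auto simp: finite_edges)
  also have "card {a \<in> edges E. snd (fst a) = u} = size (filter_mset (\<lambda>e. snd e = u) E)"
    by (rule card_edges_filter)
  finally show ?thesis .
qed

lemma indegree_restrict_graph:
  "int (size (filter_mset (\<lambda>e. snd e = i + 1) E))
    = int (size (restrict_graph E (i + 1))) - int (size (restrict_graph E i))"
  using size_restrict_graph_Suc[OF graph, of i] by auto

end

locale enumerated_simple_flow = enumerated_flow +
  assumes simple: "\<And>i j. count E (i, j) > 1 \<Longrightarrow> i = 1"
begin

lemma inner_arc:
  assumes "k \<in> arcs" "2 \<le> src k"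
  shows "h k = ((src k, tgt k), 0)" "(src k, tgt k) \<in># E"
proof -
  have hk: "h k = ((src k, tgt k), snd (h k))" by (simp add: src_def tgt_def)
  have "h k \<in> edges E" using h_in[OF assms(1)] assms(2) by (auto simp: inner_arcs_def src_def)
  then have less: "snd (h k) < count E (src k, tgt k)"
    by (subst (asm) hk) (simp add: edges_def)
  have "count E (src k, tgt k) \<le> 1"
    using simple[of "src k" "tgt k"] assms(2) by linarith
  with less have "snd (h k) = 0" by linarith
  then show "h k = ((src k, tgt k), 0)" using hk by simp
  show "(src k, tgt k) \<in># E" using less by (simp add: count_greater_zero_iff[symmetric] del: count_greater_zero_iff)
qed

text \<open>
  The entry of an array at \<open>(j, i)\<close> is the flow on the edge from \<open>i + 1\<close> to \<open>j + 1\<close>. Arcs out of the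
  source and of the vertex \<open>1\<close> carry no flow and have no entry.
\<close>

definition represents :: "(nat \<times> nat \<Rightarrow> nat) \<Rightarrow> (nat \<Rightarrow> nat) \<Rightarrow> bool" where
  "represents b g \<longleftrightarrow>
     (\<forall>k\<in>arcs. src k \<le> 1 \<longrightarrow> g k = 0) \<and>
     (\<forall>k\<in>arcs. 2 \<le> src k \<longrightarrow> b (tgt k - 1, src k - 1) = g k) \<and>
     (\<forall>i j. 1 \<le> i \<and> i < j \<and> j \<le> n \<and> (i + 1, j + 1) \<notin># E \<longrightarrow> b (j, i) = 0)"

lemma represents_outer: "represents b g \<Longrightarrow> k \<in> arcs \<Longrightarrow> src k \<le> 1 \<Longrightarrow> g k = 0"
  and represents_inner: "represents b g \<Longrightarrow> k \<in> arcs \<Longrightarrow> 2 \<le> src k \<Longrightarrow> b (tgt k - 1, src k - 1) = g k"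
  and represents_missing:
    "represents b g \<Longrightarrow> 1 \<le> i \<Longrightarrow> i < j \<Longrightarrow> j \<le> n \<Longrightarrow> (i + 1, j + 1) \<notin># E \<Longrightarrow> b (j, i) = 0"
  unfolding represents_def by blast+

lemma represents_out:
  assumes "represents b g" "i \<in> {1..n - 1}"
  shows "arc_sum src arcs g (i + 1) = (\<Sum>j\<in>{i + 1..n}. b (j, i))"
proof -
  have "(\<Sum>j\<in>{i + 1..n}. b (j, i)) = (\<Sum>j\<in>{j \<in> {i + 1..n}. (i + 1, j + 1) \<in># E}. b (j, i))"
  proof (rule sum.mono_neutral_right)
    show "\<forall>j\<in>{i + 1..n} - {j \<in> {i + 1..n}. (i + 1, j + 1) \<in># E}. b (j, i) = 0"
      using assms(2) represents_missing[OF assms(1)] by auto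
  qed auto
  also have "\<dots> = (\<Sum>k\<in>{k \<in> arcs. src k = i + 1}. g k)"
  proof (rule sum.reindex_bij_witness[where i = "\<lambda>k. tgt k - 1" and j = "\<lambda>j. arc_index ((i + 1, j + 1), 0)"])
    fix k assume "k \<in> {k \<in> arcs. src k = i + 1}"
    then have k: "k \<in> arcs" "src k = i + 1" "2 \<le> src k" using assms(2) by auto
    note inner = inner_arc[OF k(1,3)]
    have "tgt k - 1 + 1 = tgt k" using arc_bounds(2)[OF k(1)] by simp
    then show "arc_index ((i + 1, tgt k - 1 + 1), 0) = k"
      using arc_index_h[OF k(1)] inner(1) k(2) by simp
    show "tgt k - 1 \<in> {j \<in> {i + 1..n}. (i + 1, j + 1) \<in># E}"
      using arc_bounds[OF k(1)] inner(2) k(2) by auto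
  next
    fix j assume "j \<in> {j \<in> {i + 1..n}. (i + 1, j + 1) \<in># E}"
    then have e: "(i + 1, j + 1) \<in># E" by simp
    let ?k = "arc_index ((i + 1, j + 1), 0)"
    show "tgt ?k - 1 = j" "?k \<in> {k \<in> arcs. src k = i + 1}"
      using edge_arc[OF e] by simp_all
    have "b (tgt ?k - 1, src ?k - 1) = g ?k"
      using assms(2) edge_arc[OF e] by (intro represents_inner[OF assms(1)]) auto
    then show "g ?k = b (j, i)" using edge_arc[OF e] by simp
  qed
  finally show ?thesis by (simp add: arc_sum_def)
qed

lemma represents_in:
  assumes "represents b g" "i \<in> {1..n - 1}"
  shows "arc_sum tgt arcs g (i + 1) = (\<Sum>l\<in>{1..<i}. b (i, l))"
proof -
  have "(\<Sum>l\<in>{1..<i}. b (i, l)) = (\<Sum>l\<in>{l \<in> {1..<i}. (l + 1, i + 1) \<in># E}. b (i, l))"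
  proof (rule sum.mono_neutral_right)
    show "\<forall>l\<in>{1..<i} - {l \<in> {1..<i}. (l + 1, i + 1) \<in># E}. b (i, l) = 0"
    proof
      fix l assume "l \<in> {1..<i} - {l \<in> {1..<i}. (l + 1, i + 1) \<in># E}"
      then show "b (i, l) = 0"
        using assms(2) by (intro represents_missing[OF assms(1)]) auto
    qed
  qed auto
  also have "\<dots> = (\<Sum>k\<in>{k \<in> arcs. tgt k = i + 1 \<and> 2 \<le> src k}. g k)"
  proof (rule sum.reindex_bij_witness[where i = "\<lambda>k. src k - 1" and j = "\<lambda>l. arc_index ((l + 1, i + 1), 0)"])
    fix k assume "k \<in> {k \<in> arcs. tgt k = i + 1 \<and> 2 \<le> src k}"
    then have k: "k \<in> arcs" "tgt k = i + 1" "2 \<le> src k" by auto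
    note inner = inner_arc[OF k(1,3)]
    have "src k - 1 + 1 = src k" using k(3) by simp
    then show "arc_index ((src k - 1 + 1, i + 1), 0) = k"
      using arc_index_h[OF k(1)] inner(1) k(2) by simp
    show "src k - 1 \<in> {l \<in> {1..<i}. (l + 1, i + 1) \<in># E}"
      using arc_bounds[OF k(1)] inner(2) k(2,3) by auto
  next
    fix l assume "l \<in> {l \<in> {1..<i}. (l + 1, i + 1) \<in># E}"
    then have e: "(l + 1, i + 1) \<in># E" and l: "1 \<le> l" by simp_all
    let ?k = "arc_index ((l + 1, i + 1), 0)"
    show "src ?k - 1 = l" "?k \<in> {k \<in> arcs. tgt k = i + 1 \<and> 2 \<le> src k}"
      using edge_arc[OF e] l by simp_all
    have "b (tgt ?k - 1, src ?k - 1) = g ?k"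
      using edge_arc[OF e] l by (intro represents_inner[OF assms(1)]) auto
    then show "g ?k = b (i, l)" using edge_arc[OF e] by simp
  qed
  also have "\<dots> = (\<Sum>k\<in>{k \<in> arcs. tgt k = i + 1}. g k)"
  proof (rule sum.mono_neutral_left)
    show "\<forall>k\<in>{k \<in> arcs. tgt k = i + 1} - {k \<in> arcs. tgt k = i + 1 \<and> 2 \<le> src k}. g k = 0"
    proof
      fix k assume "k \<in> {k \<in> arcs. tgt k = i + 1} - {k \<in> arcs. tgt k = i + 1 \<and> 2 \<le> src k}"
      then show "g k = 0" by (intro represents_outer[OF assms(1)]) auto
    qed
  qed auto
  finally show ?thesis by (simp add: arc_sum_def)
qed

abbreviation "flows \<equiv> network_flows src tgt V arcs (\<lambda>u. if u = 0 then 1 else 0)"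

text \<open>
  The source may send out less than its supply \<open>1\<close>. The vertex \<open>1\<close> is entered only by the arc from the
  source, which carries \<open>0\<close>, so it may send out less than \<open>0 + 1 + 0\<close>.
\<close>

lemma network_flows_vanish:
  assumes "g \<in> flows" "k \<in> arcs" "src k \<le> 1"
  shows "g k = 0"
proof -
  have bound: "arc_sum src arcs g u < (if u = 0 then 1 else 0) + card {k \<in> arcs. tgt k = u} + arc_sum tgt arcs g u"
    if "u \<in> V" for u
    using assms(1) that by (simp add: network_flows_def)
  have no_in: "{k \<in> arcs. tgt k = 0} = {}" using arc_bounds(2) by fastforce
  then have in_0: "arc_sum tgt arcs g 0 = 0"
    unfolding arc_sum_def no_in by simp
  have "arc_sum src arcs g 0 = 0"
    using bound[of 0] unfolding in_0 no_in by simp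
  then have zero: "g k = 0" if "k \<in> arcs" "src k = 0" for k
    using that by (simp add: arc_sum_def)
  have "filter_mset (\<lambda>e. snd e = 1) E = {#}"
    using graph by (force simp: multigraph_on_def)
  then have "card {k \<in> arcs. tgt k = 1} = 1" using card_tgt[of 1] by simp
  moreover have "arc_sum tgt arcs g 1 = 0"
    unfolding arc_sum_def using arc_bounds(1) zero by (intro sum.neutral) fastforce
  ultimately have "arc_sum src arcs g 1 = 0" using bound[of 1] by simp
  then have "g k = 0" if "k \<in> arcs" "src k = 1" for k
    using that by (simp add: arc_sum_def)
  then show ?thesis using zero assms(2,3) by (metis One_nat_def le_SucE le_zero_eq)
qed

text \<open>
  The conditions at the vertices \<open>0\<close>, \<open>1\<close> and \<open>n + 1\<close> hold because these send out nothing. At \<open>i + 1\<close>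
  with \<open>i\<close> in \<open>{1..n - 1}\<close>, the arc from the source turns the strict inequality for flows into the weak
  one for arrays.
\<close>

lemma represents_iff:
  assumes rep: "represents b g" and ext: "g \<in> arcs \<rightarrow>\<^sub>E UNIV" "b \<in> triangle n \<rightarrow>\<^sub>E UNIV"
  shows "g \<in> flows \<longleftrightarrow> b \<in> graph_arrays n E"
proof -
  have vanish: "arc_sum src arcs g u = 0" if "u \<le> 1 \<or> u = n + 1" for u
    unfolding arc_sum_def
  proof (rule sum.neutral, rule ballI)
    fix k assume "k \<in> {k \<in> arcs. src k = u}"
    then have k: "k \<in> arcs" "src k = u" by auto
    have "src k < n + 1" using arc_bounds[OF k(1)] by linarith
    with that k have "src k \<le> 1" by auto
    then show "g k = 0" by (rule represents_outer[OF rep k(1)])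
  qed
  have step: "arc_sum src arcs g (i + 1) < card {k \<in> arcs. tgt k = i + 1} + arc_sum tgt arcs g (i + 1)
    \<longleftrightarrow> (\<Sum>k\<in>{i + 1..n}. int (b (k, i)))
          \<le> int (size (restrict_graph E (i + 1))) - int (size (restrict_graph E i))
             + (\<Sum>k\<in>{1..<i}. int (b (i, k)))" if i: "i \<in> {1..n - 1}" for i
  proof -
    have "card {k \<in> arcs. tgt k = i + 1} = Suc (size (filter_mset (\<lambda>e. snd e = i + 1) E))"
      using i by (intro card_tgt) auto
    then show ?thesis
      unfolding represents_out[OF rep i] represents_in[OF rep i] indegree_restrict_graph[symmetric]
      by (simp only: of_nat_sum[symmetric] of_nat_add[symmetric] of_nat_le_iff) linarith
  qed
  have "g \<in> flows \<longleftrightarrow> (\<forall>u\<in>V. arc_sum src arcs g u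
      < (if u = 0 then 1 else 0) + card {k \<in> arcs. tgt k = u} + arc_sum tgt arcs g u)"
    using ext(1) by (simp add: network_flows_def)
  also have "\<dots> \<longleftrightarrow> (\<forall>i\<in>{1..n - 1}. arc_sum src arcs g (i + 1)
      < card {k \<in> arcs. tgt k = i + 1} + arc_sum tgt arcs g (i + 1))"
  proof (intro iffI ballI)
    fix i assume all: "\<forall>u\<in>V. arc_sum src arcs g u
      < (if u = 0 then 1 else 0) + card {k \<in> arcs. tgt k = u} + arc_sum tgt arcs g u"
      and "i \<in> {1..n - 1}"
    then have "i + 1 \<in> V" by auto
    then show "arc_sum src arcs g (i + 1) < card {k \<in> arcs. tgt k = i + 1} + arc_sum tgt arcs g (i + 1)"
      using all[rule_format, of "i + 1"] by simp
  next
    fix u assume all: "\<forall>i\<in>{1..n - 1}. arc_sum src arcs g (i + 1)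
      < card {k \<in> arcs. tgt k = i + 1} + arc_sum tgt arcs g (i + 1)" and u: "u \<in> V"
    show "arc_sum src arcs g u
      < (if u = 0 then 1 else 0) + card {k \<in> arcs. tgt k = u} + arc_sum tgt arcs g u"
    proof (cases "u \<le> 1 \<or> u = n + 1")
      case True
      then show ?thesis using vanish[OF True] card_tgt[of u] u by (cases "u = 0") auto
    next
      case False
      then have "u - 1 \<in> {1..n - 1}" and eq: "u - 1 + 1 = u" and "u \<noteq> 0" using u by auto
      from all[rule_format, OF this(1)] show ?thesis
        unfolding eq using \<open>u \<noteq> 0\<close> by simp
    qed
  qed
  also have "\<dots> \<longleftrightarrow> b \<in> graph_arrays n E"
    unfolding graph_arrays_def
    using ext(2) represents_missing[OF rep] by (simp only: ball_cong[OF refl step]) blast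
  finally show ?thesis .
qed

definition array_of :: "(nat \<Rightarrow> nat) \<Rightarrow> nat \<times> nat \<Rightarrow> nat" where
  "array_of g = (\<lambda>(j, i)\<in>triangle n. if (i + 1, j + 1) \<in># E then g (arc_index ((i + 1, j + 1), 0)) else 0)"

definition flow_of_array :: "(nat \<times> nat \<Rightarrow> nat) \<Rightarrow> nat \<Rightarrow> nat" where
  "flow_of_array b = (\<lambda>k\<in>arcs. if src k \<le> 1 then 0 else b (tgt k - 1, src k - 1))"

lemma inner_arc_triangle:
  assumes "k \<in> arcs" "2 \<le> src k"
  shows "(tgt k - 1, src k - 1) \<in> triangle n"
  using arc_bounds[OF assms(1)] assms(2) by (auto simp: triangle_def)

lemma array_of_inner_arc:
  assumes "k \<in> arcs" "2 \<le> src k"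
  shows "array_of g (tgt k - 1, src k - 1) = g k"
proof -
  have "src k - 1 + 1 = src k" "tgt k - 1 + 1 = tgt k"
    using arc_bounds[OF assms(1)] assms(2) by auto
  then show ?thesis
    using inner_arc_triangle[OF assms] inner_arc[OF assms] arc_index_h[OF assms(1)]
    by (simp add: array_of_def)
qed

lemma represents_array_of:
  assumes "g \<in> flows"
  shows "represents (array_of g) g"
  unfolding represents_def
proof (intro conjI ballI allI impI)
  fix i j assume ij: "1 \<le> i \<and> i < j \<and> j \<le> n \<and> (i + 1, j + 1) \<notin># E"
  then have "(j, i) \<in> triangle n" by (auto simp: triangle_def)
  then show "array_of g (j, i) = 0" using ij by (simp add: array_of_def)
qed (use network_flows_vanish[OF assms] array_of_inner_arc in auto)

lemma represents_flow_of_array: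
  assumes "b \<in> graph_arrays n E"
  shows "represents b (flow_of_array b)"
  using assms by (simp add: represents_def flow_of_array_def graph_arrays_def)

theorem card_flows: "card flows = card (graph_arrays n E)"
proof (rule bij_betw_same_card, rule bij_betw_byWitness[where f = array_of and f' = flow_of_array])
  have flow_ext: "flow_of_array b \<in> arcs \<rightarrow>\<^sub>E UNIV" for b by (simp add: flow_of_array_def)
  have array_ext: "array_of g \<in> triangle n \<rightarrow>\<^sub>E UNIV" for g by (simp add: array_of_def)
  show "array_of ` flows \<subseteq> graph_arrays n E"
  proof (rule image_subsetI)
    fix g assume g: "g \<in> flows"
    then have "g \<in> arcs \<rightarrow>\<^sub>E UNIV" by (simp add: network_flows_def)
    then show "array_of g \<in> graph_arrays n E"
      using represents_iff[OF represents_array_of[OF g] _ array_ext] g by blast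
  qed
  show "flow_of_array ` graph_arrays n E \<subseteq> flows"
  proof (rule image_subsetI)
    fix b assume b: "b \<in> graph_arrays n E"
    then have "b \<in> triangle n \<rightarrow>\<^sub>E UNIV" by (simp add: graph_arrays_def)
    then show "flow_of_array b \<in> flows"
      using represents_iff[OF represents_flow_of_array[OF b] flow_ext] b by blast
  qed
  show "\<forall>g\<in>flows. flow_of_array (array_of g) = g"
  proof (intro ballI ext)
    fix g k assume g: "g \<in> flows"
    show "flow_of_array (array_of g) k = g k"
    proof (cases "k \<in> arcs")
      case True
      then show ?thesis
        using network_flows_vanish[OF g True] array_of_inner_arc[OF True, of g]
        by (auto simp: flow_of_array_def)
    next
      case False
      then show ?thesis using g by (auto simp: flow_of_array_def network_flows_def PiE_def extensional_def)
    qed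
  qed
  show "\<forall>b\<in>graph_arrays n E. array_of (flow_of_array b) = b"
  proof (intro ballI ext)
    fix b and p :: "nat \<times> nat" assume b: "b \<in> graph_arrays n E"
    obtain j i where p: "p = (j, i)" by (cases p)
    show "array_of (flow_of_array b) p = b p"
    proof (cases "p \<in> triangle n")
      case True
      then have ij: "1 \<le> i" "i < j" "j \<le> n" by (auto simp: p triangle_def)
      show ?thesis
      proof (cases "(i + 1, j + 1) \<in># E")
        case e: True
        then show ?thesis using True ij edge_arc[OF e] by (simp add: array_of_def flow_of_array_def p)
      next
        case False
        then have "b (j, i) = 0" using b ij by (simp add: graph_arrays_def)
        with False True show ?thesis by (simp add: array_of_def p)
      qed
    next
      case False
      then show ?thesis using b by (auto simp: p array_of_def graph_arrays_def PiE_def extensional_def)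
    qed
  qed
qed

end

lemma enumeration_exists:
  assumes "multigraph_on {1..n + 1} E"
  obtains d h where "enumerated_flow n E d h"
proof -
  let ?z = "((0, n + 1), 0) :: arc"
  let ?J = "inner_arcs n E - {?z}"
  obtain h0 where h0: "bij_betw h0 {0..<card ?J} ?J"
    using ex_bij_betw_nat_finite[of ?J] finite_inner_arcs by blast
  define d where "d = card ?J"
  have "bij_betw (h0(d := ?z)) ({0..<d} \<union> {d}) (?J \<union> {?z})"
  proof (rule bij_betw_combine)
    show "bij_betw (h0(d := ?z)) {0..<d} ?J"
      using h0 unfolding d_def by (subst bij_betw_cong[of _ _ h0]) auto
    show "bij_betw (h0(d := ?z)) {d} {?z}" by (simp add: bij_betw_def)
  qed auto
  moreover have "{0..<d} \<union> {d} = {..<Suc d}" by auto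
  moreover have "?J \<union> {?z} = inner_arcs n E" by (auto simp: inner_arcs_def)
  ultimately have "bij_betw (h0(d := ?z)) {..<Suc d} (inner_arcs n E)" by (simp only:)
  then have "enumerated_flow n E d (h0(d := ?z))"
    using assms by (simp add: enumerated_flow_def)
  then show thesis by (rule that)
qed

theorem theorem5:
  fixes n :: nat and E :: "(nat \<times> nat) multiset"
  assumes "n \<ge> 1"
    and "multigraph_on {1..n + 1} E"
    and "\<And>i j. count E (i, j) > 1 \<Longrightarrow> i = 1"
  shows "normalized_volume (flow_polytope (tilde_vertices n) (tilde_edges n E))
           = real (card (graph_arrays n E))"
proof -
  obtain d h where "enumerated_flow n E d h"
    using enumeration_exists[OF assms(2)] .
  then interpret enumerated_simple_flow n E d h
    using assms(3) by (intro enumerated_simple_flow.intro enumerated_simple_flow_axioms.intro)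
  show ?thesis by (simp only: normalized_volume_network_flows card_flows)
qed

end
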